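(* Let $\Theta\subset\mathbb{R}^p$ be compact, $\theta_0\in\Theta$, let $\Theta\to M(T)$, $\theta\mapsto\mu_\theta$, be continuous (total variation norm on $M(T)$), and suppose that for $\theta\in\Theta$, $\mathcal{K}\mu_\theta(t)=\mathcal{K}\mu_{\theta_0}(t)$ for all $t\in T$ implies $\theta=\theta_0$. Let $h_0=\mathcal{K}\mu_{\theta_0}$, $X^\varepsilon=h_0+\varepsilon Z$ for $\varepsilon>0$, let $\hat\theta_\varepsilon\in\Theta$ be a maximizer over $\Theta$ of $$\Phi_\varepsilon(\theta)=\langle\mu_\theta,X^\varepsilon\rangle-\tfrac12\langle\mu_\theta,\mathcal{K}\mu_\theta\rangle,$$ and put $\hat\mu_\varepsilon=\mu_{\hat\theta_\varepsilon}$, $\hat h_\varepsilon=\mathcal{K}\hat\mu_\varepsilon$. Then, almost surely as $\varepsilon\to0$, $\hat\theta_\varepsilon\to\theta_0$ in $\mathbb{R}^p$, $\hat\mu_\varepsilon\to\mu_{\theta_0}$ in $M(T)$, and $\hat h_\varepsilon\to h_0$ both in $C(T)$ and in $H_{P_0}$.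
   Context: $T\subset\mathbb{R}$ is a closed bounded interval; $C(T)$ is the Banach space of continuous real functions on $T$ with the sup norm; $M(T)=C(T)^*$ is the space of finite signed Borel measures on $T$ with the total variation norm; $\langle\mu,x\rangle=\int_T x_t\,\mu(dt)$. $Z$ is a centered Gaussian vector on $C(T)$, i.e. a $C(T)$-valued random vector on a probability space $(\Omega,\mathbb{P})$ such that $\langle\mu,Z\rangle$ is a centered normal variable for every $\mu\in M(T)$. Its covariance function $K(s,t)=\mathrm{Cov}[Z_s,Z_t]$ is continuous on $T^2$ and its covariance operator $\mathcal{K}:M(T)\to C(T)$ is $(\mathcal{K}\mu)(s)=\int_T K(s,t)\,\mu(dt)$. $P_0$ is the law of $Z$ on $C(T)$. The Hilbert space $H_{P_0}$: let $I^*:M(T)\to L^2(C(T),P_0)$ send $\mu$ to the function $x\mapsto\langle\mu,x\rangle$, let $\mathscr{X}^*_{P_0}$ be the closure of $I^*(M(T))$ in $L^2(C(T),P_0)$, and let $I:\mathscr{X}^*_{P_0}\to C(T)$ be defined by $\langle g,Iz\rangle=(I^*g,z)_{L^2(P_0)}$ for all $g\in M(T)$. Then $I$ is injective, $\mathcal{K}=II^*$, and $H_{P_0}=I(\mathscr{X}^*_{P_0})$ with inner product $(h_1,h_2)_{H_{P_0}}=(I^{-1}h_1,I^{-1}h_2)_{L^2(P_0)}$; in particular $\|\mathcal{K}\mu\|_{H_{P_0}}^2=\langle\mu,\mathcal{K}\mu\rangle$. *)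

theory Defs
  imports "HOL-Probability.Probability"
begin

section \<open>The spaces \<open>C(T)\<close> and \<open>M(T)\<close>\<close>

text \<open>
  Elements of \<open>C(T)\<close> are functions on the reals that are \<^const>\<open>undefined\<close> outside \<open>T\<close>
  (\<^const>\<open>extensional\<close>), so that equality in \<open>C(T)\<close> is equality on \<open>T\<close>.
  For compact \<open>T\<close> the boundedness built into \<^const>\<open>cfunspace\<close> is automatic,
  and the distance is the sup distance.
\<close>

definition C_space :: "real set \<Rightarrow> (real \<Rightarrow> real) metric" where
  "C_space T = cfunspace (top_of_set T) euclidean_metric"

lemma mspace_C_space:
  assumes "compact T"
  shows "mspace (C_space T) = {x. x \<in> extensional T \<and> continuous_on T x}"
proof -
  have *: "Metric_space.mbounded UNIV dist (x ` T)" if "continuous_on T x" for x :: "real \<Rightarrow> real"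
  proof -
    have "bounded (x ` T)"
      using assms that by (simp add: compact_continuous_image compact_imp_bounded)
    then show ?thesis
      by (simp add: Metric_space.mbounded_def[OF Met_TC.Metric_space_axioms] bounded_subset_cball
          Met_TC.mbounded_def subset_iff bounded_def)
  qed
  then show ?thesis
    by (auto simp: C_space_def)
qed

definition C_borel :: "real set \<Rightarrow> (real \<Rightarrow> real) measure" where
  "C_borel T = sigma (mspace (C_space T)) {U. openin (mtopology_of (C_space T)) U}"

abbreviation Borel_sets :: "real set \<Rightarrow> real set set" where
  "Borel_sets T \<equiv> sets (restrict_space borel T)"

text \<open>
  A signed measure is a set function; it is set to \<open>0\<close> on non-Borel sets, so that equality of
  signed measures is equality on Borel sets. Finiteness is built into the value type.
\<close>

definition signed_measures :: "real set \<Rightarrow> (real set \<Rightarrow> real) set" where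
  "signed_measures T = {\<mu>.
     (\<forall>A. A \<notin> Borel_sets T \<longrightarrow> \<mu> A = 0) \<and>
     \<mu> {} = 0 \<and>
     (\<forall>A. range A \<subseteq> Borel_sets T \<longrightarrow> disjoint_family A \<longrightarrow> (\<lambda>n::nat. \<mu> (A n)) sums \<mu> (\<Union>n. A n))}"

definition tv_norm :: "real set \<Rightarrow> (real set \<Rightarrow> real) \<Rightarrow> real" where
  "tv_norm T \<mu> = (SUP P\<in>{P. finite P \<and> P \<subseteq> Borel_sets T \<and> partition_on T P}. \<Sum>A\<in>P. \<bar>\<mu> A\<bar>)"

text \<open>Positive part of the Jordan decomposition; the negative part is the positive part of \<open>-\<mu>\<close>.\<close>

definition jordan_pos :: "real set \<Rightarrow> (real set \<Rightarrow> real) \<Rightarrow> real measure" where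
  "jordan_pos T \<mu> =
     measure_of T (Borel_sets T) (\<lambda>A. ennreal (SUP B\<in>{B \<in> Borel_sets T. B \<subseteq> A}. \<mu> B))"

definition jordan_neg :: "real set \<Rightarrow> (real set \<Rightarrow> real) \<Rightarrow> real measure" where
  "jordan_neg T \<mu> = jordan_pos T (\<lambda>A. - \<mu> A)"

definition pairing :: "real set \<Rightarrow> (real set \<Rightarrow> real) \<Rightarrow> (real \<Rightarrow> real) \<Rightarrow> real" where
  "pairing T \<mu> x = (LINT t|jordan_pos T \<mu>. x t) - (LINT t|jordan_neg T \<mu>. x t)"


section \<open>Gaussian vectors on \<open>C(T)\<close>\<close>

text \<open>A centered normal variable may be degenerate, i.e. almost surely \<open>0\<close>.\<close>

definition centered_normal :: "'w measure \<Rightarrow> ('w \<Rightarrow> real) \<Rightarrow> bool" where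
  "centered_normal M X \<longleftrightarrow>
     (\<exists>\<sigma>>0. distributed M lborel X (\<lambda>x. ennreal (normal_density 0 \<sigma> x))) \<or>
     (X \<in> borel_measurable M \<and> (AE \<omega> in M. X \<omega> = 0))"

definition centered_gaussian_vector :: "'w measure \<Rightarrow> real set \<Rightarrow> ('w \<Rightarrow> real \<Rightarrow> real) \<Rightarrow> bool" where
  "centered_gaussian_vector M T Z \<longleftrightarrow>
     Z \<in> M \<rightarrow>\<^sub>M C_borel T \<and>
     (\<forall>\<mu>\<in>signed_measures T. centered_normal M (\<lambda>\<omega>. pairing T \<mu> (Z \<omega>)))"

definition cov_fun :: "'w measure \<Rightarrow> ('w \<Rightarrow> real \<Rightarrow> real) \<Rightarrow> real \<Rightarrow> real \<Rightarrow> real" where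
  "cov_fun M Z s t =
     (LINT \<omega>|M. (Z \<omega> s - (LINT \<omega>'|M. Z \<omega>' s)) * (Z \<omega> t - (LINT \<omega>'|M. Z \<omega>' t)))"

definition cov_op ::
  "'w measure \<Rightarrow> real set \<Rightarrow> ('w \<Rightarrow> real \<Rightarrow> real) \<Rightarrow> (real set \<Rightarrow> real) \<Rightarrow> (real \<Rightarrow> real)" where
  "cov_op M T Z \<mu> = (\<lambda>s\<in>T. pairing T \<mu> (\<lambda>t. cov_fun M Z s t))"

definition law :: "'w measure \<Rightarrow> real set \<Rightarrow> ('w \<Rightarrow> real \<Rightarrow> real) \<Rightarrow> (real \<Rightarrow> real) measure" where
  "law M T Z = distr M (C_borel T) Z"


section \<open>The Hilbert space of a Gaussian law on \<open>C(T)\<close>\<close>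

text \<open>
  Elements of \<open>L\<^sup>2(P)\<close> are represented by square integrable functions instead of
  almost-everywhere classes. Everything below depends only on the classes.
\<close>

definition L2_space :: "'x measure \<Rightarrow> ('x \<Rightarrow> real) set" where
  "L2_space P = {f \<in> borel_measurable P. integrable P (\<lambda>x. (f x)\<^sup>2)}"

definition L2_inner :: "'x measure \<Rightarrow> ('x \<Rightarrow> real) \<Rightarrow> ('x \<Rightarrow> real) \<Rightarrow> real" where
  "L2_inner P f g = (LINT x|P. f x * g x)"

definition L2_norm :: "'x measure \<Rightarrow> ('x \<Rightarrow> real) \<Rightarrow> real" where
  "L2_norm P f = sqrt (L2_inner P f f)"

definition I_star :: "real set \<Rightarrow> (real set \<Rightarrow> real) \<Rightarrow> (real \<Rightarrow> real) \<Rightarrow> real" where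
  "I_star T \<mu> = (\<lambda>x. pairing T \<mu> x)"

definition X_star :: "real set \<Rightarrow> (real \<Rightarrow> real) measure \<Rightarrow> ((real \<Rightarrow> real) \<Rightarrow> real) set" where
  "X_star T P = {z \<in> L2_space P.
     \<forall>e>0. \<exists>\<mu>\<in>signed_measures T. L2_norm P (\<lambda>x. z x - I_star T \<mu> x) < e}"

definition I_map ::
  "real set \<Rightarrow> (real \<Rightarrow> real) measure \<Rightarrow> ((real \<Rightarrow> real) \<Rightarrow> real) \<Rightarrow> (real \<Rightarrow> real)" where
  "I_map T P z = (THE h. h \<in> mspace (C_space T) \<and>
     (\<forall>g\<in>signed_measures T. pairing T g h = L2_inner P (I_star T g) z))"

definition H_space :: "real set \<Rightarrow> (real \<Rightarrow> real) measure \<Rightarrow> (real \<Rightarrow> real) set" where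
  "H_space T P = I_map T P ` X_star T P"

text \<open>
  \<^const>\<open>inv_into\<close> picks one representative of the almost-everywhere class of the preimage,
  which is unique as a class because \<open>I\<close> is injective on classes.
\<close>

definition H_inner ::
  "real set \<Rightarrow> (real \<Rightarrow> real) measure \<Rightarrow> (real \<Rightarrow> real) \<Rightarrow> (real \<Rightarrow> real) \<Rightarrow> real" where
  "H_inner T P h1 h2 =
     L2_inner P (inv_into (X_star T P) (I_map T P) h1) (inv_into (X_star T P) (I_map T P) h2)"

definition H_norm :: "real set \<Rightarrow> (real \<Rightarrow> real) measure \<Rightarrow> (real \<Rightarrow> real) \<Rightarrow> real" where
  "H_norm T P h = sqrt (H_inner T P h h)"


section \<open>The observation and the objective function\<close>

definition obs :: "real set \<Rightarrow> (real \<Rightarrow> real) \<Rightarrow> ('w \<Rightarrow> real \<Rightarrow> real) \<Rightarrow> real \<Rightarrow> 'w \<Rightarrow> real \<Rightarrow> real" where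
  "obs T h Z \<epsilon> \<omega> = (\<lambda>t\<in>T. h t + \<epsilon> * Z \<omega> t)"

definition objective ::
  "'w measure \<Rightarrow> real set \<Rightarrow> ('w \<Rightarrow> real \<Rightarrow> real) \<Rightarrow> ('p \<Rightarrow> real set \<Rightarrow> real) \<Rightarrow> (real \<Rightarrow> real) \<Rightarrow> 'p \<Rightarrow> real"
  where
  "objective M T Z \<mu> x \<theta> =
     pairing T (\<mu> \<theta>) x - 1/2 * pairing T (\<mu> \<theta>) (cov_op M T Z (\<mu> \<theta>))"

end

theory Submission
  imports Defs
begin

text \<open>
  Write \<open>\<nu>\<^sub>\<theta> = \<mu>\<^sub>\<theta> - \<mu>\<^sub>\<theta>\<^sub>0\<close> and \<open>q(\<theta>) = \<langle>\<nu>\<^sub>\<theta>, K \<nu>\<^sub>\<theta>\<rangle> = E \<langle>\<nu>\<^sub>\<theta>, Z\<rangle>\<^sup>2\<close>. Completing the square, the objective at \<open>\<theta>\<close> is a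
  constant plus \<open>\<epsilon> \<langle>\<mu>\<^sub>\<theta>, Z\<rangle> - q(\<theta>) / 2\<close>. Since \<open>q(\<theta>\<^sub>0) = 0\<close>, comparing the maximizer with \<open>\<theta>\<^sub>0\<close> gives
  \<open>q(\<theta>_hat) \<le> 2 \<epsilon> \<langle>\<mu>_hat - \<mu>\<^sub>\<theta>\<^sub>0, Z\<rangle>\<close>, and the pairing is bounded over the compact set \<open>\<Theta>\<close> for each fixed path
  of \<open>Z\<close>. Hence \<open>q(\<theta>_hat) \<longlongrightarrow> 0\<close>. By identifiability the continuous function \<open>q\<close> has \<open>\<theta>\<^sub>0\<close> as its only
  zero on \<open>\<Theta>\<close>, so compactness forces \<open>\<theta>_hat \<longlongrightarrow> \<theta>\<^sub>0\<close>; convergence of the measures and, as \<open>K\<close> is bounded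
  from \<open>M(T)\<close> to \<open>C(T)\<close>, uniform convergence of \<open>h_hat\<close> follow. Finally \<open>\<parallel>h_hat - h\<^sub>0\<parallel>\<^sup>2 = q(\<theta>_hat)\<close> in
  the Hilbert space norm. The argument works for every \<open>\<omega>\<close>, not only almost surely.

  The groundwork has three parts. The set functions of \<^const>\<open>signed_measures\<close> are bounded
  (\<open>signed_measure_bounded\<close>), which yields the Jordan decomposition and the estimate
  \<open>\<bar>\<langle>\<mu>, x\<rangle>\<bar> \<le> sup \<bar>x\<bar> \<parallel>\<mu>\<parallel>\<close> (\<open>pairing_bound\<close>). For centered normal variables pointwise convergence to \<open>0\<close>
  implies convergence in \<open>L\<^sup>2\<close> (\<open>centered_normal_tendsto_L2\<close>), which makes the covariance separately
  continuous and bounded, and justifies \<open>E (\<langle>\<mu>, Z\<rangle> Y) = \<langle>\<mu>, E (Z Y)\<rangle>\<close> for square integrable \<open>Y\<close>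
  (\<open>expectation_pairing_Z\<close>). From this identity come \<open>K = I I\<^sup>*\<close> and \<open>\<parallel>K \<nu>\<parallel>\<^sup>2 = \<langle>\<nu>, K \<nu>\<rangle>\<close>
  (\<open>H_norm_cov_op\<close>).
\<close>

section \<open>Jordan decomposition of signed measures\<close>

lemma signed_measuresD:
  assumes "\<mu> \<in> signed_measures T"
  shows signed_measure_empty: "\<mu> {} = 0"
    and signed_measure_sums: "range F \<subseteq> Borel_sets T \<Longrightarrow> disjoint_family F \<Longrightarrow>
          (\<lambda>n::nat. \<mu> (F n)) sums \<mu> (\<Union>n. F n)"
  using assms by (auto simp: signed_measures_def)

lemma space_restrict_borel: "space (restrict_space borel T) = T"
  by (simp add: space_restrict_space)

lemma Borel_sets_T: "T \<in> Borel_sets T"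
  using sets.top[of "restrict_space borel T"] by (simp add: space_restrict_borel)

lemma Borel_sets_subset: "A \<in> Borel_sets T \<Longrightarrow> A \<subseteq> T"
  using sets.sets_into_space[of A "restrict_space borel T"] by (simp add: space_restrict_borel)

lemma signed_measure_add:
  assumes \<mu>: "\<mu> \<in> signed_measures T" and A: "A \<in> Borel_sets T" and B: "B \<in> Borel_sets T"
    and disj: "A \<inter> B = {}"
  shows "\<mu> (A \<union> B) = \<mu> A + \<mu> B"
proof -
  have "(\<lambda>n. \<mu> (binaryset A B n)) sums \<mu> (\<Union>n. binaryset A B n)"
    by (rule signed_measure_sums[OF \<mu>])
       (use A B disj in \<open>auto simp: range_binaryset_eq disjoint_family_on_def binaryset_def\<close>)
  moreover have "(\<lambda>n. \<mu> (binaryset A B n)) sums (\<mu> A + \<mu> B)"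
    by (rule binaryset_sums) (rule signed_measure_empty[OF \<mu>])
  ultimately show ?thesis
    by (metis UN_binaryset_eq sums_unique2)
qed

lemma signed_measure_Diff:
  assumes "\<mu> \<in> signed_measures T" "A \<in> Borel_sets T" "B \<in> Borel_sets T" "B \<subseteq> A"
  shows "\<mu> (A - B) = \<mu> A - \<mu> B"
  using signed_measure_add[OF assms(1), of "A - B" B] assms
  by (simp add: Diff_disjoint inf_commute Un_absorb2)

lemma signed_measures_diff:
  assumes "\<mu> \<in> signed_measures T" "\<nu> \<in> signed_measures T"
  shows "(\<lambda>A. \<mu> A - \<nu> A) \<in> signed_measures T"
  using assms unfolding signed_measures_def
  by (auto intro!: sums_diff)

lemma signed_measures_uminus:
  assumes "\<mu> \<in> signed_measures T"
  shows "(\<lambda>A. - \<mu> A) \<in> signed_measures T"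
  using assms unfolding signed_measures_def
  by (auto intro!: sums_minus)

text \<open>
  If \<open>\<mu>\<close> were unbounded, repeated splitting would produce disjoint sets of measure larger than \<open>1\<close>
  in absolute value, contradicting convergence of the series over these sets.
\<close>
lemma signed_measure_bounded:
  assumes \<mu>: "\<mu> \<in> signed_measures T"
  shows "\<exists>C. \<forall>A\<in>Borel_sets T. \<bar>\<mu> A\<bar> \<le> C"
proof (rule ccontr)
  \<comment> \<open>\<open>\<mu>\<close> is unbounded on the Borel subsets of a bad set.\<close>
  define bad where "bad A \<longleftrightarrow> A \<in> Borel_sets T \<and>
    (\<forall>C. \<exists>B\<in>Borel_sets T. B \<subseteq> A \<and> \<bar>\<mu> B\<bar> > C)" for A
  assume "\<not> ?thesis"
  then have bad_T: "bad T"
    unfolding bad_def using Borel_sets_T Borel_sets_subset by (meson not_le)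
  have step: "\<exists>B. bad B \<and> B \<subseteq> A \<and> \<bar>\<mu> (A - B)\<bar> > 1" if "bad A" for A
  proof -
    have A: "A \<in> Borel_sets T" using that by (simp add: bad_def)
    from that obtain B where B: "B \<in> Borel_sets T" "B \<subseteq> A" "\<bar>\<mu> B\<bar> > \<bar>\<mu> A\<bar> + 1"
      unfolding bad_def by blast
    have AB: "A - B \<in> Borel_sets T" using A B by auto
    have d: "\<mu> (A - B) = \<mu> A - \<mu> B" by (rule signed_measure_Diff[OF \<mu> A B(1,2)])
    \<comment> \<open>Both parts have measure above \<open>1\<close> in absolute value; a bad one is kept.\<close>
    have "bad B \<or> bad (A - B)"
    proof (rule ccontr)
      assume "\<not> ?thesis"
      then obtain C D where C: "\<And>E. E \<in> Borel_sets T \<Longrightarrow> E \<subseteq> B \<Longrightarrow> \<bar>\<mu> E\<bar> \<le> C"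
        and D: "\<And>E. E \<in> Borel_sets T \<Longrightarrow> E \<subseteq> A - B \<Longrightarrow> \<bar>\<mu> E\<bar> \<le> D"
        using B AB unfolding bad_def by (meson not_le)
      from \<open>bad A\<close> obtain E where E: "E \<in> Borel_sets T" "E \<subseteq> A" "\<bar>\<mu> E\<bar> > C + D"
        unfolding bad_def by blast
      have "E = (E \<inter> B) \<union> (E - B)" by blast
      then have "\<mu> E = \<mu> (E \<inter> B) + \<mu> (E - B)"
        using signed_measure_add[OF \<mu> sets.Int[OF E(1) B(1)] sets.Diff[OF E(1) B(1)]]
        by (metis Int_Diff_disjoint)
      moreover have "\<bar>\<mu> (E \<inter> B)\<bar> \<le> C" using C[of "E \<inter> B"] E(1) B(1) by auto
      moreover have "\<bar>\<mu> (E - B)\<bar> \<le> D" using D[of "E - B"] E(1,2) B(1) by auto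
      ultimately show False using E(3) by linarith
    qed
    moreover have "A - (A - B) = B" using B by blast
    moreover have "\<bar>\<mu> (A - B)\<bar> > 1" "\<bar>\<mu> B\<bar> > 1"
      using B(3) d by linarith+
    ultimately show ?thesis
      using B(2) by (metis Diff_subset)
  qed
  have "\<exists>A. \<forall>n. bad (A n) \<and> A (Suc n) \<subseteq> A n \<and> \<bar>\<mu> (A n - A (Suc n))\<bar> > 1"
    using dependent_nat_choice[of "\<lambda>_::nat. bad" "\<lambda>_ A B. B \<subseteq> A \<and> \<bar>\<mu> (A - B)\<bar> > 1", OF exI[of bad T, OF bad_T]]
      step by metis
  then obtain A :: "nat \<Rightarrow> real set"
    where A: "\<And>n. bad (A n)" "\<And>n. A (Suc n) \<subseteq> A n" "\<And>n. \<bar>\<mu> (A n - A (Suc n))\<bar> > 1"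
    by auto
  define E where "E n = A n - A (Suc n)" for n
  have dec: "A n \<subseteq> A m" if "m \<le> n" for m n
    by (rule lift_Suc_antimono_le[of A, OF A(2) that])
  have "disjoint_family E"
    unfolding disjoint_family_on_def
  proof (intro ballI impI)
    fix m n :: nat assume "m \<noteq> n"
    then consider "Suc m \<le> n" | "Suc n \<le> m" by linarith
    then show "E m \<inter> E n = {}"
    proof cases
      case 1
      then show ?thesis using dec[OF 1] by (auto simp: E_def)
    next
      case 2
      then show ?thesis using dec[OF 2] by (auto simp: E_def)
    qed
  qed
  moreover have "range E \<subseteq> Borel_sets T"
    using A(1) by (auto simp: E_def bad_def)
  ultimately have "(\<lambda>n. \<mu> (E n)) sums \<mu> (\<Union>n. E n)"
    by (intro signed_measure_sums[OF \<mu>])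
  then have "(\<lambda>n. \<mu> (E n)) \<longlonglongrightarrow> 0"
    by (simp add: sums_iff summable_LIMSEQ_zero)
  then have "eventually (\<lambda>n. \<bar>\<mu> (E n)\<bar> < 1) sequentially"
    using tendstoD[of "\<lambda>n. \<mu> (E n)" 0 sequentially 1] by simp
  then obtain n where "\<bar>\<mu> (E n)\<bar> < 1"
    using eventually_happens'[OF sequentially_bot] by blast
  then show False
    using A(3)[of n] by (simp add: E_def)
qed

text \<open>
  The supremum of \<open>\<mu>\<close> over the Borel subsets of \<open>A\<close>. The following lemmas show that it is finite
  and countably additive, so that it is the measure \<^const>\<open>jordan_pos\<close>.
\<close>
definition upper_variation :: "real set \<Rightarrow> (real set \<Rightarrow> real) \<Rightarrow> real set \<Rightarrow> real" where
  "upper_variation T \<mu> A = (SUP B\<in>{B \<in> Borel_sets T. B \<subseteq> A}. \<mu> B)"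

lemma upper_variation_bdd:
  assumes "\<mu> \<in> signed_measures T"
  shows "bdd_above (\<mu> ` {B \<in> Borel_sets T. B \<subseteq> A})"
proof -
  obtain C where "\<forall>A\<in>Borel_sets T. \<bar>\<mu> A\<bar> \<le> C"
    using signed_measure_bounded[OF assms] by blast
  then show ?thesis
    by (intro bdd_aboveI2[where M=C]) force
qed

lemma upper_variation_upper:
  assumes "\<mu> \<in> signed_measures T" "B \<in> Borel_sets T" "B \<subseteq> A"
  shows "\<mu> B \<le> upper_variation T \<mu> A"
  unfolding upper_variation_def
  by (rule cSUP_upper[OF _ upper_variation_bdd[OF assms(1)]]) (use assms in auto)

lemma upper_variation_least:
  assumes "\<And>B. B \<in> Borel_sets T \<Longrightarrow> B \<subseteq> A \<Longrightarrow> \<mu> B \<le> c"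
  shows "upper_variation T \<mu> A \<le> c"
  unfolding upper_variation_def
  by (rule cSUP_least) (use assms in auto)

lemma upper_variation_nonneg:
  assumes "\<mu> \<in> signed_measures T"
  shows "0 \<le> upper_variation T \<mu> A"
  using upper_variation_upper[OF assms, of "{}" A] signed_measure_empty[OF assms] by simp

lemma upper_variation_mono:
  assumes "\<mu> \<in> signed_measures T" "A \<subseteq> A'"
  shows "upper_variation T \<mu> A \<le> upper_variation T \<mu> A'"
  by (rule upper_variation_least) (use upper_variation_upper assms in blast)

lemma upper_variation_superadditive:
  assumes \<mu>: "\<mu> \<in> signed_measures T" and disj: "A \<inter> A' = {}"
  shows "upper_variation T \<mu> A + upper_variation T \<mu> A' \<le> upper_variation T \<mu> (A \<union> A')"
proof -
  have "upper_variation T \<mu> A \<le> upper_variation T \<mu> (A \<union> A') - upper_variation T \<mu> A'"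
  proof (rule upper_variation_least)
    fix B assume B: "B \<in> Borel_sets T" "B \<subseteq> A"
    have "upper_variation T \<mu> A' \<le> upper_variation T \<mu> (A \<union> A') - \<mu> B"
    proof (rule upper_variation_least)
      fix B' assume B': "B' \<in> Borel_sets T" "B' \<subseteq> A'"
      have "\<mu> B + \<mu> B' = \<mu> (B \<union> B')"
        using B B' disj by (intro signed_measure_add[OF \<mu>, symmetric]) auto
      also have "\<dots> \<le> upper_variation T \<mu> (A \<union> A')"
        using B B' by (intro upper_variation_upper[OF \<mu>]) auto
      finally show "\<mu> B' \<le> upper_variation T \<mu> (A \<union> A') - \<mu> B" by linarith
    qed
    then show "\<mu> B \<le> upper_variation T \<mu> (A \<union> A') - upper_variation T \<mu> A'" by linarith
  qed
  then show ?thesis by linarith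
qed

lemma upper_variation_sums:
  assumes \<mu>: "\<mu> \<in> signed_measures T"
    and F: "range F \<subseteq> Borel_sets T" "disjoint_family F"
  shows "(\<lambda>n::nat. upper_variation T \<mu> (F n)) sums upper_variation T \<mu> (\<Union>n. F n)"
proof -
  let ?u = "upper_variation T \<mu>"
  have partial: "(\<Sum>n<N. ?u (F n)) \<le> ?u (\<Union>n<N. F n)" for N
  proof (induction N)
    case 0
    show ?case by (simp add: upper_variation_nonneg[OF \<mu>])
  next
    case (Suc N)
    have "F n \<inter> F N = {}" if "n < N" for n
      using disjoint_family_onD[OF F(2), of n N] that by simp
    then have "(\<Union>n<N. F n) \<inter> F N = {}" by blast
    from upper_variation_superadditive[OF \<mu> this] Suc show ?case
      by (simp add: lessThan_Suc Un_commute)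
  qed
  have partial': "(\<Sum>n<N. ?u (F n)) \<le> ?u (\<Union>n. F n)" for N
  proof -
    have "(\<Union>n<N. F n) \<subseteq> (\<Union>n. F n)" by blast
    from upper_variation_mono[OF \<mu> this] partial[of N] show ?thesis by linarith
  qed
  have sm: "summable (\<lambda>n. ?u (F n))"
    by (rule summableI_nonneg_bounded[where x="?u (\<Union>n. F n)"])
       (simp_all add: upper_variation_nonneg[OF \<mu>] partial')
  have "(\<Sum>n. ?u (F n)) \<le> ?u (\<Union>n. F n)"
    by (rule suminf_le_const[OF sm]) (rule partial')
  moreover have "?u (\<Union>n. F n) \<le> (\<Sum>n. ?u (F n))"
  proof (rule upper_variation_least)
    fix B assume B: "B \<in> Borel_sets T" "B \<subseteq> (\<Union>n. F n)"
    have "(\<lambda>n. \<mu> (B \<inter> F n)) sums \<mu> (\<Union>n. B \<inter> F n)"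
      using F B by (intro signed_measure_sums[OF \<mu>]) (auto simp: disjoint_family_on_def)
    moreover have "(\<Union>n. B \<inter> F n) = B" using B by blast
    ultimately have s: "(\<lambda>n. \<mu> (B \<inter> F n)) sums \<mu> B" by simp
    have "\<mu> (B \<inter> F n) \<le> ?u (F n)" for n
      using F B by (intro upper_variation_upper[OF \<mu>]) auto
    then show "\<mu> B \<le> (\<Sum>n. ?u (F n))"
      by (rule sums_le[OF _ s summable_sums[OF sm]])
  qed
  ultimately show ?thesis using sm by (simp add: sums_iff)
qed

lemma sets_jordan_pos [measurable_cong]: "sets (jordan_pos T \<mu>) = Borel_sets T"
  and space_jordan_pos: "space (jordan_pos T \<mu>) = T"
  using sets.sigma_sets_eq[of "restrict_space borel T"] sets.space_closed[of "restrict_space borel T"]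
  by (auto simp: jordan_pos_def sets_measure_of space_measure_of space_restrict_borel)

lemma sets_jordan_neg [measurable_cong]: "sets (jordan_neg T \<mu>) = Borel_sets T"
  and space_jordan_neg: "space (jordan_neg T \<mu>) = T"
  by (simp_all add: jordan_neg_def sets_jordan_pos space_jordan_pos)

lemma emeasure_jordan_pos:
  assumes \<mu>: "\<mu> \<in> signed_measures T" and A: "A \<in> Borel_sets T"
  shows "emeasure (jordan_pos T \<mu>) A = ennreal (upper_variation T \<mu> A)"
proof -
  have sa: "sigma_algebra T (Borel_sets T)"
    using sets.sigma_algebra_axioms[of "restrict_space borel T"] by (simp add: space_restrict_borel)
  show ?thesis
    unfolding jordan_pos_def upper_variation_def[symmetric]
  proof (rule emeasure_measure_of_sigma[OF sa _ _ A])
    show "positive (Borel_sets T) (\<lambda>A. ennreal (upper_variation T \<mu> A))"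
      using upper_variation_least[where A="{}" and T=T and \<mu>=\<mu> and c=0] signed_measure_empty[OF \<mu>]
      by (auto simp: positive_def ennreal_eq_0_iff)
    show "countably_additive (Borel_sets T) (\<lambda>A. ennreal (upper_variation T \<mu> A))"
      unfolding countably_additive_def
    proof (intro allI impI)
      fix F :: "nat \<Rightarrow> real set"
      assume "range F \<subseteq> Borel_sets T" "disjoint_family F"
      from upper_variation_sums[OF \<mu> this]
      show "(\<Sum>n. ennreal (upper_variation T \<mu> (F n))) = ennreal (upper_variation T \<mu> (\<Union>n. F n))"
        by (intro suminf_ennreal_eq) (auto simp: upper_variation_nonneg[OF \<mu>])
    qed
  qed
qed

lemma measure_jordan_pos:
  assumes "\<mu> \<in> signed_measures T" "A \<in> Borel_sets T"
  shows "measure (jordan_pos T \<mu>) A = upper_variation T \<mu> A"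
  using emeasure_jordan_pos[OF assms] upper_variation_nonneg[OF assms(1)]
  by (simp add: measure_def)

lemma finite_measure_jordan_pos:
  assumes "\<mu> \<in> signed_measures T"
  shows "finite_measure (jordan_pos T \<mu>)"
  by (rule finite_measureI) (simp add: space_jordan_pos emeasure_jordan_pos[OF assms Borel_sets_T])

lemma finite_measure_jordan_neg:
  assumes "\<mu> \<in> signed_measures T"
  shows "finite_measure (jordan_neg T \<mu>)"
  unfolding jordan_neg_def by (intro finite_measure_jordan_pos signed_measures_uminus assms)

lemma jordan_decomposition:
  assumes \<mu>: "\<mu> \<in> signed_measures T" and A: "A \<in> Borel_sets T"
  shows "\<mu> A = measure (jordan_pos T \<mu>) A - measure (jordan_neg T \<mu>) A"
proof -
  let ?n = "\<lambda>A. - \<mu> A"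
  have n: "?n \<in> signed_measures T" by (rule signed_measures_uminus[OF \<mu>])
  have "upper_variation T \<mu> A \<le> upper_variation T ?n A + \<mu> A"
  proof (rule upper_variation_least)
    fix B assume B: "B \<in> Borel_sets T" "B \<subseteq> A"
    have "- \<mu> (A - B) \<le> upper_variation T ?n A"
      using upper_variation_upper[OF n, of "A - B" A] A B by auto
    then show "\<mu> B \<le> upper_variation T ?n A + \<mu> A"
      using signed_measure_Diff[OF \<mu> A B] by simp
  qed
  moreover have "upper_variation T ?n A \<le> upper_variation T \<mu> A - \<mu> A"
  proof (rule upper_variation_least)
    fix B assume B: "B \<in> Borel_sets T" "B \<subseteq> A"
    have "\<mu> (A - B) \<le> upper_variation T \<mu> A"
      using upper_variation_upper[OF \<mu>, of "A - B" A] A B by auto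
    then show "- \<mu> B \<le> upper_variation T \<mu> A - \<mu> A"
      using signed_measure_Diff[OF \<mu> A B] by simp
  qed
  ultimately show ?thesis
    by (simp add: jordan_neg_def measure_jordan_pos[OF \<mu> A] measure_jordan_pos[OF n A])
qed

text \<open>
  The supremum defining \<^const>\<open>tv_norm\<close> is finite, and partitions into a set and its complement
  already give the bound. The empty set must be discarded from such a pair because a partition has
  no empty parts.
\<close>
lemma total_variation_le_tv_norm:
  assumes \<mu>: "\<mu> \<in> signed_measures T"
  shows "measure (jordan_pos T \<mu>) T + measure (jordan_neg T \<mu>) T \<le> tv_norm T \<mu>"
proof -
  interpret p: finite_measure "jordan_pos T \<mu>" by (rule finite_measure_jordan_pos[OF \<mu>])
  interpret n: finite_measure "jordan_neg T \<mu>" by (rule finite_measure_jordan_neg[OF \<mu>])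
  let ?parts = "{P. finite P \<and> P \<subseteq> Borel_sets T \<and> partition_on T P}"
  have bdd: "bdd_above ((\<lambda>P. \<Sum>A\<in>P. \<bar>\<mu> A\<bar>) ` ?parts)"
  proof (rule bdd_aboveI2)
    fix P assume P: "P \<in> ?parts"
    have "(\<Sum>A\<in>P. \<bar>\<mu> A\<bar>) \<le> (\<Sum>A\<in>P. measure (jordan_pos T \<mu>) A + measure (jordan_neg T \<mu>) A)"
    proof (rule sum_mono)
      fix A assume "A \<in> P"
      then have "A \<in> Borel_sets T" using P by auto
      from jordan_decomposition[OF \<mu> this]
      show "\<bar>\<mu> A\<bar> \<le> measure (jordan_pos T \<mu>) A + measure (jordan_neg T \<mu>) A"
        using measure_nonneg[of "jordan_pos T \<mu>" A] measure_nonneg[of "jordan_neg T \<mu>" A] by linarith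
    qed
    also have "\<dots> = measure (jordan_pos T \<mu>) (\<Union>P) + measure (jordan_neg T \<mu>) (\<Union>P)"
    proof -
      have "disjoint_family_on (\<lambda>A. A) P"
        using P by (auto simp: partition_on_def disjoint_def disjoint_family_on_def)
      then show ?thesis
        using P p.finite_measure_finite_Union[of P "\<lambda>A. A"] n.finite_measure_finite_Union[of P "\<lambda>A. A"]
        by (simp add: sum.distrib sets_jordan_pos sets_jordan_neg image_subset_iff subset_iff)
    qed
    also have "\<dots> = measure (jordan_pos T \<mu>) T + measure (jordan_neg T \<mu>) T"
      using P by (auto simp: partition_on_def)
    finally show "(\<Sum>A\<in>P. \<bar>\<mu> A\<bar>) \<le> measure (jordan_pos T \<mu>) T + measure (jordan_neg T \<mu>) T" .
  qed
  have two_sets: "\<bar>\<mu> B\<bar> + \<bar>\<mu> (T - B)\<bar> \<le> tv_norm T \<mu>" if B: "B \<in> Borel_sets T" for B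
  proof -
    let ?P = "{B, T - B} - {{}}"
    have "\<bar>\<mu> B\<bar> + \<bar>\<mu> (T - B)\<bar> = (\<Sum>A\<in>?P. \<bar>\<mu> A\<bar>)"
    proof (cases "B = T - B")
      case True
      then have "B = {}" "T = {}" by auto
      then show ?thesis using signed_measure_empty[OF \<mu>] by simp
    next
      case False
      then have "\<bar>\<mu> B\<bar> + \<bar>\<mu> (T - B)\<bar> = (\<Sum>A\<in>{B, T - B}. \<bar>\<mu> A\<bar>)" by simp
      also have "\<dots> = (\<Sum>A\<in>?P. \<bar>\<mu> A\<bar>)"
        by (rule sum.mono_neutral_right) (auto simp: signed_measure_empty[OF \<mu>])
      finally show ?thesis .
    qed
    also have "\<dots> \<le> tv_norm T \<mu>"
      unfolding tv_norm_def
    proof (rule cSUP_upper[OF _ bdd])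
      have "B \<subseteq> T" by (rule Borel_sets_subset[OF B])
      then show "?P \<in> ?parts"
        using B Borel_sets_T[of T] by (auto simp: partition_on_def disjoint_def)
    qed
    finally show ?thesis .
  qed
  have "upper_variation T \<mu> T \<le> (tv_norm T \<mu> + \<mu> T) / 2"
  proof (rule upper_variation_least)
    fix B assume B: "B \<in> Borel_sets T" "B \<subseteq> T"
    show "\<mu> B \<le> (tv_norm T \<mu> + \<mu> T) / 2"
      using two_sets[OF B(1)] signed_measure_Diff[OF \<mu> Borel_sets_T B] by (simp add: field_simps)
  qed
  then show ?thesis
    using jordan_decomposition[OF \<mu> Borel_sets_T] measure_jordan_pos[OF \<mu> Borel_sets_T]
    by (simp add: field_simps)
qed

section \<open>The pairing of measures and continuous functions\<close>

lemma borel_measurable_sets_eq: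
  assumes "sets m = sets N" "f \<in> borel_measurable N"
  shows "f \<in> borel_measurable m"
  using assms(2) by (simp add: measurable_cong_sets[OF assms(1) refl])

lemma tendsto_sum_list_map:
  fixes f :: "'a \<Rightarrow> 'b \<Rightarrow> real"
  assumes "\<And>x. x \<in> set xs \<Longrightarrow> ((\<lambda>n. f n x) \<longlongrightarrow> l x) F"
  shows "((\<lambda>n. \<Sum>x\<leftarrow>xs. f n x) \<longlongrightarrow> (\<Sum>x\<leftarrow>xs. l x)) F"
  using assms by (induction xs) (auto intro!: tendsto_add)

text \<open>
  A linear relation between finite measures passes to the integrals of bounded functions. The list
  of pairs (coefficient, measure) suits explicit combinations of Jordan components.
\<close>
lemma lincomb_integral_zero:
  fixes f :: "'a \<Rightarrow> real" and L :: "(real \<times> 'a measure) list"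
  assumes fin: "\<And>p. p \<in> set L \<Longrightarrow> finite_measure (snd p)"
    and sets_eq: "\<And>p. p \<in> set L \<Longrightarrow> sets (snd p) = sets N"
    and zero: "\<And>A. A \<in> sets N \<Longrightarrow> (\<Sum>p\<leftarrow>L. fst p * measure (snd p) A) = 0"
    and f: "f \<in> borel_measurable N" and bound: "\<And>x. x \<in> space N \<Longrightarrow> \<bar>f x\<bar> \<le> C"
  shows "(\<Sum>p\<leftarrow>L. fst p * (\<integral>x. f x \<partial>snd p)) = 0"
proof -
  have sp: "space (snd p) = space N" if "p \<in> set L" for p
    by (rule sets_eq_imp_space_eq[OF sets_eq[OF that]])
  have int: "integrable (snd p) u"
    if "p \<in> set L" "u \<in> borel_measurable N" "\<And>x. x \<in> space N \<Longrightarrow> \<bar>u x\<bar> \<le> D" for p and u :: "'a \<Rightarrow> real" and D :: real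
  proof -
    interpret finite_measure "snd p" by (rule fin[OF that(1)])
    have "u \<in> borel_measurable (snd p)"
      by (rule borel_measurable_sets_eq[OF sets_eq[OF that(1)] that(2)])
    then show ?thesis
      using that(3) sp[OF that(1)] by (intro integrable_const_bound[where B=D]) auto
  qed
  have nonneg: "(\<exists>D. \<forall>x\<in>space N. u x \<le> D) \<longrightarrow> (\<Sum>p\<leftarrow>L. fst p * (\<integral>x. u x \<partial>snd p)) = 0"
    if u: "u \<in> borel_measurable N" "\<And>x. 0 \<le> u x" for u :: "'a \<Rightarrow> real"
    using u
  proof (induction rule: borel_measurable_induct_real)
    case (set A)
    have "(\<Sum>p\<leftarrow>L. fst p * (\<integral>x. indicator A x \<partial>snd p)) = (\<Sum>p\<leftarrow>L. fst p * measure (snd p) A)"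
    proof (intro arg_cong[where f=sum_list] map_cong refl)
      fix p assume p: "p \<in> set L"
      then have "A \<in> sets (snd p)" using set sets_eq by simp
      then show "fst p * (\<integral>x. indicator A x \<partial>snd p) = fst p * measure (snd p) A"
        by (simp add: sets.Int_space_eq2)
    qed
    then show ?case using zero[OF set] by simp
  next
    case (mult u c)
    show ?case
    proof (intro impI)
      assume "\<exists>D. \<forall>x\<in>space N. c * u x \<le> D"
      then obtain D where D: "\<forall>x\<in>space N. c * u x \<le> D" ..
      show "(\<Sum>p\<leftarrow>L. fst p * (\<integral>x. c * u x \<partial>snd p)) = 0"
      proof (cases "c = 0")
        case True
        have "(\<Sum>p\<leftarrow>L. 0::real) = 0" by (induction L) auto
        with True show ?thesis by simp
      next
        case False
        then have "\<forall>x\<in>space N. u x \<le> D / c" using D mult.hyps(1) by (simp add: field_simps)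
        then have "(\<Sum>p\<leftarrow>L. fst p * (\<integral>x. u x \<partial>snd p)) = 0" using mult.IH by blast
        moreover have "(\<Sum>p\<leftarrow>L. fst p * (\<integral>x. c * u x \<partial>snd p)) = c * (\<Sum>p\<leftarrow>L. fst p * (\<integral>x. u x \<partial>snd p))"
          by (simp add: sum_list_const_mult[symmetric] mult.left_commute)
        ultimately show ?thesis by simp
      qed
    qed
  next
    case (add u v)
    show ?case
    proof (intro impI)
      assume "\<exists>D. \<forall>x\<in>space N. v x + u x \<le> D"
      then obtain D where D: "\<And>x. x\<in>space N \<Longrightarrow> v x + u x \<le> D" by blast
      have u: "\<bar>u x\<bar> \<le> D" and v: "\<bar>v x\<bar> \<le> D" if "x \<in> space N" for x
        using D[OF that] add.hyps(2)[of x] add.hyps(4)[of x] by linarith+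
      have "(\<Sum>p\<leftarrow>L. fst p * (\<integral>x. v x + u x \<partial>snd p))
          = (\<Sum>p\<leftarrow>L. fst p * (\<integral>x. v x \<partial>snd p) + fst p * (\<integral>x. u x \<partial>snd p))"
      proof (intro arg_cong[where f=sum_list] map_cong refl)
        fix p assume p: "p \<in> set L"
        have "integrable (snd p) u" "integrable (snd p) v"
          by (rule int[OF p add.hyps(1) u] int[OF p add.hyps(3) v], assumption)+
        then show "fst p * (\<integral>x. v x + u x \<partial>snd p) = fst p * (\<integral>x. v x \<partial>snd p) + fst p * (\<integral>x. u x \<partial>snd p)"
          by (simp add: algebra_simps)
      qed
      also have "\<dots> = 0"
      proof -
        have "\<exists>D. \<forall>x\<in>space N. u x \<le> D" "\<exists>D. \<forall>x\<in>space N. v x \<le> D"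
          using u v by (meson abs_le_D1)+
        then show ?thesis using add.IH by (simp add: sum_list_addf)
      qed
      finally show "(\<Sum>p\<leftarrow>L. fst p * (\<integral>x. v x + u x \<partial>snd p)) = 0" .
    qed
  next
    case (seq U)
    show ?case
    proof (intro impI)
      assume "\<exists>D. \<forall>x\<in>space N. u x \<le> D"
      then obtain D where D: "\<And>x. x\<in>space N \<Longrightarrow> u x \<le> D" by blast
      have le: "U i x \<le> u x" if "x \<in> space N" for i x
        by (rule incseq_le[OF _ seq.hyps(4)[OF that]]) (use seq.hyps(3) in \<open>auto simp: incseq_def le_fun_def\<close>)
      have bd: "\<bar>U i x\<bar> \<le> D" if "x \<in> space N" for i x
        using le[OF that, of i] D[OF that] seq.hyps(2)[of i x] by linarith
      have "(\<lambda>i. \<Sum>p\<leftarrow>L. fst p * (\<integral>x. U i x \<partial>snd p)) \<longlonglongrightarrow> (\<Sum>p\<leftarrow>L. fst p * (\<integral>x. u x \<partial>snd p))"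
      proof (intro tendsto_sum_list_map tendsto_mult tendsto_const)
        fix p assume p: "p \<in> set L"
        interpret finite_measure "snd p" by (rule fin[OF p])
        have m: "U i \<in> borel_measurable (snd p)" "u \<in> borel_measurable (snd p)" for i
          using borel_measurable_sets_eq[OF sets_eq[OF p]] seq.hyps(1) u(1) by blast+
        show "(\<lambda>i. \<integral>x. U i x \<partial>snd p) \<longlonglongrightarrow> (\<integral>x. u x \<partial>snd p)"
          by (rule integral_dominated_convergence[where w="\<lambda>_. D"])
             (use m bd seq.hyps(4) sp[OF p] in auto)
      qed
      moreover have "(\<Sum>p\<leftarrow>L. fst p * (\<integral>x. U i x \<partial>snd p)) = 0" for i
        using seq.IH[of i] bd by (meson abs_le_D1)
      ultimately show "(\<Sum>p\<leftarrow>L. fst p * (\<integral>x. u x \<partial>snd p)) = 0"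
        by (simp add: LIMSEQ_const_iff)
    qed
  qed
  let ?p = "\<lambda>x. max 0 (f x)" and ?n = "\<lambda>x. max 0 (- f x)"
  have m: "?p \<in> borel_measurable N" "?n \<in> borel_measurable N" using f by auto
  have b: "\<bar>?p x\<bar> \<le> C" "\<bar>?n x\<bar> \<le> C" if "x \<in> space N" for x
    using bound[OF that] by auto
  have "(\<Sum>p\<leftarrow>L. fst p * (\<integral>x. f x \<partial>snd p))
      = (\<Sum>p\<leftarrow>L. fst p * (\<integral>x. ?p x \<partial>snd p) - fst p * (\<integral>x. ?n x \<partial>snd p))"
  proof (intro arg_cong[where f=sum_list] map_cong refl)
    fix p assume p: "p \<in> set L"
    have i: "integrable (snd p) ?p" "integrable (snd p) ?n"
      by (rule int[OF p m(1) b(1)] int[OF p m(2) b(2)], assumption)+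
    have "f = (\<lambda>x. ?p x - ?n x)" by auto
    then have "(\<integral>x. f x \<partial>snd p) = (\<integral>x. ?p x - ?n x \<partial>snd p)" by metis
    then show "fst p * (\<integral>x. f x \<partial>snd p) = fst p * (\<integral>x. ?p x \<partial>snd p) - fst p * (\<integral>x. ?n x \<partial>snd p)"
      using i by (simp add: right_diff_distrib)
  qed
  also have "\<dots> = 0"
  proof -
    have "\<exists>D. \<forall>x\<in>space N. ?p x \<le> D" "\<exists>D. \<forall>x\<in>space N. ?n x \<le> D"
      using b by (meson abs_le_D1)+
    then show ?thesis
      using nonneg[OF m(1)] nonneg[OF m(2)] by (simp add: sum_list_subtractf)
  qed
  finally show ?thesis .
qed

lemma C_spaceD:
  assumes "compact T" "x \<in> mspace (C_space T)"
  shows C_space_continuous: "continuous_on T x"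
    and C_space_extensional: "x \<in> extensional T"
  using assms by (auto simp: mspace_C_space)

lemma C_spaceI:
  assumes "compact T" "continuous_on T x"
  shows "(\<lambda>t\<in>T. x t) \<in> mspace (C_space T)"
  using assms by (simp add: mspace_C_space cong: continuous_on_cong)

lemma continuous_on_compact_bound:
  fixes x :: "real \<Rightarrow> real"
  assumes "compact T" "continuous_on T x"
  obtains C where "0 \<le> C" "\<And>t. t \<in> T \<Longrightarrow> \<bar>x t\<bar> \<le> C"
proof -
  have "bounded (x ` T)"
    using assms by (intro compact_imp_bounded compact_continuous_image)
  then obtain C where C: "\<forall>t\<in>T. \<bar>x t\<bar> \<le> C" by (auto simp: bounded_iff)
  show thesis by (rule that[of "\<bar>C\<bar>"]) (use C in force)+
qed

lemma integrable_finite_borel: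
  fixes x :: "real \<Rightarrow> real"
  assumes "finite_measure m" "sets m = Borel_sets T" "compact T" "continuous_on T x"
  shows "integrable m x"
proof -
  interpret finite_measure m by fact
  obtain C where C: "\<And>t. t \<in> T \<Longrightarrow> \<bar>x t\<bar> \<le> C"
    using continuous_on_compact_bound[OF assms(3,4)] by blast
  have "x \<in> borel_measurable m"
    by (rule borel_measurable_sets_eq[OF assms(2) borel_measurable_continuous_on_restrict[OF assms(4)]])
  moreover have "space m = T"
    using sets_eq_imp_space_eq[OF assms(2)] by (simp add: space_restrict_borel)
  ultimately show ?thesis
    using C by (intro integrable_const_bound[where B=C]) auto
qed

lemma integrable_jordan:
  fixes x :: "real \<Rightarrow> real"
  assumes "\<mu> \<in> signed_measures T" "compact T" "continuous_on T x"
  shows "integrable (jordan_pos T \<mu>) x" "integrable (jordan_neg T \<mu>) x"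
  by (rule integrable_finite_borel[OF finite_measure_jordan_pos[OF assms(1)] sets_jordan_pos assms(2,3)]
      integrable_finite_borel[OF finite_measure_jordan_neg[OF assms(1)] sets_jordan_neg assms(2,3)])+

text \<open>
  The pairing does not depend on the decomposition: every representation of \<open>\<mu>\<close> as a linear
  combination of finite measures computes it.
\<close>
lemma pairing_eq_lincomb:
  assumes \<mu>: "\<mu> \<in> signed_measures T"
    and fin: "\<And>p. p \<in> set L \<Longrightarrow> finite_measure (snd p)"
    and sets_eq: "\<And>p. p \<in> set L \<Longrightarrow> sets (snd p) = Borel_sets T"
    and rep: "\<And>A. A \<in> Borel_sets T \<Longrightarrow> \<mu> A = (\<Sum>p\<leftarrow>L. fst p * measure (snd p) A)"
    and T: "compact T" and x: "continuous_on T x"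
  shows "pairing T \<mu> x = (\<Sum>p\<leftarrow>L. fst p * (\<integral>t. x t \<partial>snd p))"
proof -
  obtain C where C: "\<And>t. t \<in> T \<Longrightarrow> \<bar>x t\<bar> \<le> C"
    using continuous_on_compact_bound[OF T x] by blast
  have "(\<Sum>p\<leftarrow>(-1, jordan_pos T \<mu>) # (1, jordan_neg T \<mu>) # L. fst p * (\<integral>t. x t \<partial>snd p)) = 0"
  proof (rule lincomb_integral_zero[where N="restrict_space borel T" and C=C])
    show "x \<in> borel_measurable (restrict_space borel T)"
      by (rule borel_measurable_continuous_on_restrict[OF x])
    show "\<bar>x t\<bar> \<le> C" if "t \<in> space (restrict_space borel T)" for t
      using C that by (simp add: space_restrict_borel)
    fix A assume "A \<in> Borel_sets T"
    then show "(\<Sum>p\<leftarrow>(-1, jordan_pos T \<mu>) # (1, jordan_neg T \<mu>) # L. fst p * measure (snd p) A) = 0"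
      using rep[of A] jordan_decomposition[OF \<mu>, of A] by simp
  qed (use fin sets_eq in \<open>auto simp: finite_measure_jordan_pos[OF \<mu>] finite_measure_jordan_neg[OF \<mu>]
         sets_jordan_pos sets_jordan_neg\<close>)
  then show ?thesis by (simp add: pairing_def)
qed

lemma pairing_diff_measure:
  assumes "\<mu> \<in> signed_measures T" "\<nu> \<in> signed_measures T" "compact T" "continuous_on T x"
  shows "pairing T (\<lambda>A. \<mu> A - \<nu> A) x = pairing T \<mu> x - pairing T \<nu> x"
proof -
  let ?L = "[(1, jordan_pos T \<mu>), (-1, jordan_neg T \<mu>), (-1, jordan_pos T \<nu>), (1, jordan_neg T \<nu>)]"
  have "pairing T (\<lambda>A. \<mu> A - \<nu> A) x = (\<Sum>p\<leftarrow>?L. fst p * (\<integral>t. x t \<partial>snd p))"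
    by (rule pairing_eq_lincomb[OF signed_measures_diff[OF assms(1,2)] _ _ _ assms(3,4)])
       (use assms(1,2) in \<open>auto simp: finite_measure_jordan_pos finite_measure_jordan_neg
         sets_jordan_pos sets_jordan_neg jordan_decomposition\<close>)
  then show ?thesis by (simp add: pairing_def)
qed

text \<open>The point mass at \<open>t\<close>, with the value \<open>0\<close> on non-Borel sets that signed measures require.\<close>
definition dirac :: "real set \<Rightarrow> real \<Rightarrow> real set \<Rightarrow> real" where
  "dirac T t A = (if A \<in> Borel_sets T then indicator A t else 0)"

lemma dirac_signed_measure: "dirac T t \<in> signed_measures T"
proof -
  have "(\<lambda>n. indicator (F n) t :: real) sums indicator (\<Union>n. F n) t"
    if "disjoint_family F" for F :: "nat \<Rightarrow> real set"
  proof (cases "t \<in> (\<Union>n. F n)")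
    case False
    then show ?thesis by (auto simp: indicator_def)
  next
    case True
    then obtain k where k: "t \<in> F k" by blast
    then have "t \<notin> F n" if "n \<noteq> k" for n
      using disjoint_family_onD[OF \<open>disjoint_family F\<close>, of n k] that by blast
    then have "(\<lambda>n. indicator (F n) t :: real) = (\<lambda>n. if n = k then 1 else 0)"
      using k by (auto simp: fun_eq_iff indicator_def)
    moreover have "indicator (\<Union>n. F n) t = (1::real)" using True by (simp add: indicator_def)
    ultimately show ?thesis using sums_single[of k "\<lambda>_. 1::real"] by simp
  qed
  moreover have "(\<Union>n. F n) \<in> Borel_sets T" if "range F \<subseteq> Borel_sets T" for F :: "nat \<Rightarrow> real set"
    using that by auto
  ultimately show ?thesis
    by (auto simp: signed_measures_def dirac_def image_subset_iff)
qed

lemma pairing_dirac: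
  assumes "compact T" "t \<in> T" "continuous_on T x"
  shows "pairing T (dirac T t) x = x t"
proof -
  let ?N = "restrict_space borel T"
  have "pairing T (dirac T t) x = (\<Sum>p\<leftarrow>[(1, return ?N t)]. fst p * (\<integral>t. x t \<partial>snd p))"
  proof (rule pairing_eq_lincomb[OF dirac_signed_measure _ _ _ assms(1,3)])
    show "finite_measure (snd p)" if "p \<in> set [(1::real, return ?N t)]" for p
      using that prob_space_return[of t ?N] assms(2)
      by (auto simp: space_restrict_borel prob_space_def)
  qed (auto simp: dirac_def measure_return)
  also have "\<dots> = x t"
    using integral_return[of t ?N x] borel_measurable_continuous_on_restrict[OF assms(3)] assms(2)
    by (simp add: space_restrict_borel)
  finally show ?thesis .
qed

lemma pairing_cong:
  assumes "\<And>t. t \<in> T \<Longrightarrow> x t = y t"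
  shows "pairing T \<mu> x = pairing T \<mu> y"
  unfolding pairing_def
  by (intro arg_cong2[where f="(-)"] Bochner_Integration.integral_cong)
     (use assms in \<open>auto simp: space_jordan_pos space_jordan_neg\<close>)

lemma pairing_add:
  assumes "\<mu> \<in> signed_measures T" "compact T" "continuous_on T x" "continuous_on T y"
  shows "pairing T \<mu> (\<lambda>t. x t + y t) = pairing T \<mu> x + pairing T \<mu> y"
  using integrable_jordan[OF assms(1,2,3)] integrable_jordan[OF assms(1,2,4)]
  by (simp add: pairing_def)

lemma pairing_diff:
  assumes "\<mu> \<in> signed_measures T" "compact T" "continuous_on T x" "continuous_on T y"
  shows "pairing T \<mu> (\<lambda>t. x t - y t) = pairing T \<mu> x - pairing T \<mu> y"
  using integrable_jordan[OF assms(1,2,3)] integrable_jordan[OF assms(1,2,4)]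
  by (simp add: pairing_def)

lemma pairing_cmult: "pairing T \<mu> (\<lambda>t. c * x t) = c * pairing T \<mu> x"
  by (simp add: pairing_def algebra_simps)

lemma tv_norm_nonneg:
  assumes "\<mu> \<in> signed_measures T"
  shows "0 \<le> tv_norm T \<mu>"
  using total_variation_le_tv_norm[OF assms]
    measure_nonneg[of "jordan_pos T \<mu>" T] measure_nonneg[of "jordan_neg T \<mu>" T] by linarith

lemma pairing_bound:
  assumes \<mu>: "\<mu> \<in> signed_measures T" and T: "compact T" and x: "continuous_on T x"
    and C: "0 \<le> C" "\<And>t. t \<in> T \<Longrightarrow> \<bar>x t\<bar> \<le> C"
  shows "\<bar>pairing T \<mu> x\<bar> \<le> C * tv_norm T \<mu>"
proof -
  have *: "\<bar>\<integral>t. x t \<partial>m\<bar> \<le> C * measure m T"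
    if "finite_measure m" "sets m = Borel_sets T" for m
  proof -
    interpret finite_measure m by fact
    have sp: "space m = T"
      using sets_eq_imp_space_eq[OF that(2)] by (simp add: space_restrict_borel)
    have "\<bar>\<integral>t. x t \<partial>m\<bar> \<le> (\<integral>t. C \<partial>m)"
      by (rule order_trans[OF integral_abs_bound integral_mono])
         (use integrable_finite_borel[OF that T x] C sp in auto)
    then show ?thesis using sp by (simp add: mult.commute)
  qed
  have "\<bar>pairing T \<mu> x\<bar> \<le> C * measure (jordan_pos T \<mu>) T + C * measure (jordan_neg T \<mu>) T"
    using *[OF finite_measure_jordan_pos[OF \<mu>] sets_jordan_pos]
      *[OF finite_measure_jordan_neg[OF \<mu>] sets_jordan_neg]
    unfolding pairing_def by linarith
  also have "\<dots> \<le> C * tv_norm T \<mu>"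
    using total_variation_le_tv_norm[OF \<mu>] C(1)
    by (simp flip: distrib_left add: mult_left_mono)
  finally show ?thesis .
qed

section \<open>The Borel structure of C(T)\<close>

lemma dist_le_mdist_C_space:
  assumes "x \<in> mspace (C_space T)" "y \<in> mspace (C_space T)" "t \<in> T"
  shows "\<bar>x t - y t\<bar> \<le> mdist (C_space T) x y"
  using mdist_cfunspace_imp_mdist_le[of x "top_of_set T" euclidean_metric y _ t] assms
  by (simp add: C_space_def dist_real_def)

lemma mdist_C_space_le:
  assumes "0 \<le> C" "\<And>t. t \<in> T \<Longrightarrow> \<bar>x t - y t\<bar> \<le> C"
  shows "mdist (C_space T) x y \<le> C"
  unfolding C_space_def
  by (rule mdist_cfunspace_le) (use assms in \<open>auto simp: dist_real_def\<close>)

lemma space_C_borel: "space (C_borel T) = mspace (C_space T)"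
  and openin_C_borel: "openin (mtopology_of (C_space T)) U \<Longrightarrow> U \<in> sets (C_borel T)"
proof -
  have "{U. openin (mtopology_of (C_space T)) U} \<subseteq> Pow (mspace (C_space T))"
    using openin_subset[of "mtopology_of (C_space T)"] by auto
  then show "space (C_borel T) = mspace (C_space T)"
    "openin (mtopology_of (C_space T)) U \<Longrightarrow> U \<in> sets (C_borel T)"
    by (auto simp: C_borel_def)
qed

lemma continuous_map_C_borel:
  fixes f :: "(real \<Rightarrow> real) \<Rightarrow> real"
  assumes "continuous_map (mtopology_of (C_space T)) euclidean f"
  shows "f \<in> borel_measurable (C_borel T)"
proof (rule borel_measurableI)
  fix S :: "real set" assume "open S"
  then have "openin (mtopology_of (C_space T)) {x \<in> topspace (mtopology_of (C_space T)). f x \<in> S}"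
    using openin_continuous_map_preimage[OF assms, of S] by simp
  moreover have "f -` S \<inter> space (C_borel T) = {x \<in> topspace (mtopology_of (C_space T)). f x \<in> S}"
    by (auto simp: space_C_borel)
  ultimately show "f -` S \<inter> space (C_borel T) \<in> sets (C_borel T)"
    using openin_C_borel by metis
qed

text \<open>The pairing is Lipschitz in its second argument, with constant \<open>tv_norm T \<mu>\<close>.\<close>
lemma measurable_pairing:
  assumes \<mu>: "\<mu> \<in> signed_measures T" and T: "compact T"
  shows "pairing T \<mu> \<in> borel_measurable (C_borel T)"
proof (rule continuous_map_C_borel)
  have "Lipschitz_continuous_map (C_space T) euclidean_metric (pairing T \<mu>)"
    unfolding Lipschitz_continuous_map_def
  proof (intro conjI exI ballI)
    fix x y assume xy: "x \<in> mspace (C_space T)" "y \<in> mspace (C_space T)"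
    have "\<bar>pairing T \<mu> x - pairing T \<mu> y\<bar> = \<bar>pairing T \<mu> (\<lambda>t. x t - y t)\<bar>"
      using pairing_diff[OF \<mu> T] xy C_space_continuous[OF T] by simp
    also have "\<dots> \<le> mdist (C_space T) x y * tv_norm T \<mu>"
      using xy C_space_continuous[OF T] dist_le_mdist_C_space
      by (intro pairing_bound[OF \<mu> T]) (auto intro!: continuous_intros)
    finally show "mdist euclidean_metric (pairing T \<mu> x) (pairing T \<mu> y) \<le> tv_norm T \<mu> * mdist (C_space T) x y"
      by (simp add: dist_real_def mult.commute)
  qed auto
  then show "continuous_map (mtopology_of (C_space T)) euclidean (pairing T \<mu>)"
    using Lipschitz_continuous_imp_continuous_map by fastforce
qed

section \<open>Square integrable functions\<close>

lemma integrable_mult_square_integrable: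
  fixes f g :: "'a \<Rightarrow> real"
  assumes "f \<in> borel_measurable M" "g \<in> borel_measurable M"
    and "integrable M (\<lambda>x. (f x)\<^sup>2)" "integrable M (\<lambda>x. (g x)\<^sup>2)"
  shows "integrable M (\<lambda>x. f x * g x)"
proof (rule Bochner_Integration.integrable_bound[where f="\<lambda>x. (f x)\<^sup>2 + (g x)\<^sup>2"])
  have "\<bar>f x * g x\<bar> \<le> (f x)\<^sup>2 + (g x)\<^sup>2" for x
  proof -
    have "2 * (\<bar>f x\<bar> * \<bar>g x\<bar>) \<le> (f x)\<^sup>2 + (g x)\<^sup>2"
      using sum_squares_bound[of "\<bar>f x\<bar>" "\<bar>g x\<bar>"] by simp
    moreover have "0 \<le> \<bar>f x\<bar> * \<bar>g x\<bar>" by simp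
    ultimately show ?thesis unfolding abs_mult by linarith
  qed
  then show "AE x in M. norm (f x * g x) \<le> norm ((f x)\<^sup>2 + (g x)\<^sup>2)" by simp
qed (use assms in auto)

lemma Cauchy_Schwarz_integral:
  fixes f g :: "'a \<Rightarrow> real"
  assumes m: "f \<in> borel_measurable M" "g \<in> borel_measurable M"
    and f: "integrable M (\<lambda>x. (f x)\<^sup>2)" and g: "integrable M (\<lambda>x. (g x)\<^sup>2)"
  shows "\<bar>\<integral>x. f x * g x \<partial>M\<bar> \<le> sqrt (\<integral>x. (f x)\<^sup>2 \<partial>M) * sqrt (\<integral>x. (g x)\<^sup>2 \<partial>M)"
proof -
  define F G p where "F = (\<integral>x. (f x)\<^sup>2 \<partial>M)" and "G = (\<integral>x. (g x)\<^sup>2 \<partial>M)" and "p = (\<integral>x. f x * g x \<partial>M)"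
  have fg: "integrable M (\<lambda>x. f x * g x)"
    by (rule integrable_mult_square_integrable[OF m f g])
  have quad: "0 \<le> s\<^sup>2 * F - 2 * s * t * p + t\<^sup>2 * G" for s t
  proof -
    have "0 \<le> (\<integral>x. (s * f x - t * g x)\<^sup>2 \<partial>M)" by simp
    also have "\<dots> = (\<integral>x. s\<^sup>2 * (f x)\<^sup>2 - (2 * s * t) * (f x * g x) + t\<^sup>2 * (g x)\<^sup>2 \<partial>M)"
      by (intro Bochner_Integration.integral_cong) (auto simp: power2_eq_square algebra_simps)
    also have "\<dots> = s\<^sup>2 * F - 2 * s * t * p + t\<^sup>2 * G"
      using f g fg by (simp add: F_def G_def p_def)
    finally show ?thesis .
  qed
  have F0: "0 \<le> F" by (simp add: F_def)
  have "p\<^sup>2 \<le> F * G"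
  proof (cases "F = 0")
    case True
    have "p = 0"
    proof (rule ccontr)
      assume "p \<noteq> 0"
      then show False
        using quad[of "(G + 1) / (2 * p)" 1] True by (simp add: field_simps)
    qed
    then show ?thesis using True by simp
  next
    case False
    then have "0 < F" using F0 by simp
    moreover have "0 \<le> F * (F * G - p\<^sup>2)"
      using quad[of p F] by (simp add: power2_eq_square algebra_simps)
    ultimately show ?thesis by (simp add: zero_le_mult_iff)
  qed
  then have "sqrt (p\<^sup>2) \<le> sqrt (F * G)" by (rule real_sqrt_le_mono)
  then show ?thesis by (simp add: F_def G_def p_def real_sqrt_mult)
qed

section \<open>Centered normal variables\<close>

lemma expectation_cos_std_normal:
  "(\<integral>x. cos (t * x) \<partial>std_normal_distribution) = exp (- (t\<^sup>2) / 2)"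
proof -
  interpret real_distribution std_normal_distribution by (rule real_dist_normal_dist)
  have i: "integrable std_normal_distribution (\<lambda>x. iexp (t * x))"
    by (intro integrable_const_bound[where B=1]) auto
  have "(\<integral>x. cos (t * x) \<partial>std_normal_distribution) = (\<integral>x. Re (iexp (t * x)) \<partial>std_normal_distribution)"
    by (simp add: Re_exp)
  also have "\<dots> = Re (char std_normal_distribution t)"
    unfolding char_def by (rule integral_Re[OF i])
  also have "\<dots> = exp (- (t\<^sup>2) / 2)"
    by (simp add: char_std_normal_distribution flip: of_real_exp)
  finally show ?thesis .
qed

lemma (in prob_space)
  assumes X: "centered_normal M X"
  shows centered_normal_measurable: "X \<in> borel_measurable M"
    and centered_normal_square_integrable: "integrable M (\<lambda>\<omega>. (X \<omega>)\<^sup>2)"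
    and centered_normal_expectation: "(\<integral>\<omega>. X \<omega> \<partial>M) = 0"
    and centered_normal_cos: "(\<integral>\<omega>. cos (X \<omega>) \<partial>M) = exp (- (\<integral>\<omega>. (X \<omega>)\<^sup>2 \<partial>M) / 2)"
proof -
  have "X \<in> borel_measurable M \<and> integrable M (\<lambda>\<omega>. (X \<omega>)\<^sup>2) \<and> (\<integral>\<omega>. X \<omega> \<partial>M) = 0
      \<and> (\<integral>\<omega>. cos (X \<omega>) \<partial>M) = exp (- (\<integral>\<omega>. (X \<omega>)\<^sup>2 \<partial>M) / 2)"
    using X unfolding centered_normal_def
  proof (elim disjE exE conjE)
    assume X0: "X \<in> borel_measurable M" "AE \<omega> in M. X \<omega> = 0"
    have "AE \<omega> in M. (X \<omega>)\<^sup>2 = 0" "AE \<omega> in M. cos (X \<omega>) = 1" using X0(2) by auto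
    then have "integrable M (\<lambda>\<omega>. (X \<omega>)\<^sup>2) = integrable M (\<lambda>\<omega>. 0::real)"
      "(\<integral>\<omega>. (X \<omega>)\<^sup>2 \<partial>M) = (\<integral>\<omega>. 0 \<partial>M)" "(\<integral>\<omega>. X \<omega> \<partial>M) = (\<integral>\<omega>. 0 \<partial>M)"
      "(\<integral>\<omega>. cos (X \<omega>) \<partial>M) = (\<integral>\<omega>. 1 \<partial>M)"
      using X0 by (intro integrable_cong_AE integral_cong_AE; simp)+
    then show ?thesis using X0(1) by (simp add: prob_space)
  next
    fix \<sigma> :: real
    assume \<sigma>: "0 < \<sigma>" and D: "distributed M lborel X (\<lambda>x. ennreal (normal_density 0 \<sigma> x))"
    define Y where "Y \<omega> = X \<omega> / \<sigma>" for \<omega>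
    have "distributed M lborel Y std_normal_density"
      using D normal_standard_normal_convert[OF \<sigma>, of X 0] by (simp add: Y_def[abs_def])
    then have Y: "Y \<in> borel_measurable M" and dY: "distr M lborel Y = std_normal_distribution"
      using distributed_distr_eq_density distributed_measurable by force+
    have int: "(\<integral>\<omega>. g (Y \<omega>) \<partial>M) = (\<integral>x. g x \<partial>std_normal_distribution)"
      and intg: "integrable M (\<lambda>\<omega>. g (Y \<omega>)) = integrable std_normal_distribution g"
      if "g \<in> borel_measurable borel" for g :: "real \<Rightarrow> real"
      using that Y by (simp_all add: dY[symmetric] integral_distr integrable_distr_eq)
    have XY: "X = (\<lambda>\<omega>. \<sigma> * Y \<omega>)" using \<sigma> by (simp add: Y_def fun_eq_iff)
    have iY: "integrable M (\<lambda>\<omega>. (Y \<omega>)\<^sup>2)"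
      using intg[of "\<lambda>x. x\<^sup>2"] integrable_std_normal_distribution_moment[of 2] by simp
    have eY2: "(\<integral>\<omega>. (Y \<omega>)\<^sup>2 \<partial>M) = 1"
      using int[of "\<lambda>x. x\<^sup>2"] std_normal_distribution_even_moments(1)[of 1] by (simp add: fact_numeral)
    have eY: "(\<integral>\<omega>. Y \<omega> \<partial>M) = 0"
      using int[of "\<lambda>x. x"] integral_std_normal_distribution_moment_odd[of 1] by simp
    have "(\<integral>\<omega>. cos (X \<omega>) \<partial>M) = exp (- \<sigma>\<^sup>2 / 2)"
      using int[of "\<lambda>x. cos (\<sigma> * x)"] by (simp add: XY expectation_cos_std_normal)
    then show ?thesis
      using Y iY eY eY2 by (simp add: XY power_mult_distrib)
  qed
  then show "X \<in> borel_measurable M" "integrable M (\<lambda>\<omega>. (X \<omega>)\<^sup>2)" "(\<integral>\<omega>. X \<omega> \<partial>M) = 0"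
    "(\<integral>\<omega>. cos (X \<omega>) \<partial>M) = exp (- (\<integral>\<omega>. (X \<omega>)\<^sup>2 \<partial>M) / 2)"
    by blast+
qed

text \<open>
  For centered normal variables pointwise convergence to \<open>0\<close> entails convergence in \<open>L\<^sup>2\<close>, because
  the characteristic function at \<open>1\<close> determines the variance.
\<close>
lemma (in prob_space) centered_normal_tendsto_L2:
  assumes X: "\<And>n. centered_normal M (X n)"
    and lim: "\<And>\<omega>. \<omega> \<in> space M \<Longrightarrow> (\<lambda>n. X n \<omega>) \<longlonglongrightarrow> 0"
  shows "(\<lambda>n. \<integral>\<omega>. (X n \<omega>)\<^sup>2 \<partial>M) \<longlonglongrightarrow> 0"
proof -
  have "(\<lambda>n. \<integral>\<omega>. cos (X n \<omega>) \<partial>M) \<longlonglongrightarrow> (\<integral>\<omega>. 1 \<partial>M)"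
  proof (rule integral_dominated_convergence[where w="\<lambda>_. 1"])
    show "AE \<omega> in M. (\<lambda>n. cos (X n \<omega>)) \<longlonglongrightarrow> 1"
      using lim tendsto_cos[of "\<lambda>n. X n _" 0] by (intro AE_I2) fastforce
    show "(\<lambda>\<omega>. cos (X n \<omega>)) \<in> borel_measurable M" for n
      using centered_normal_measurable[OF X[of n]] by simp
  qed auto
  then have "(\<lambda>n. exp (- (\<integral>\<omega>. (X n \<omega>)\<^sup>2 \<partial>M) / 2)) \<longlonglongrightarrow> 1"
    by (simp add: centered_normal_cos[OF X] prob_space)
  from tendsto_ln[OF this] have "(\<lambda>n. - (\<integral>\<omega>. (X n \<omega>)\<^sup>2 \<partial>M) / 2) \<longlonglongrightarrow> 0" by simp
  from tendsto_mult[OF tendsto_const[of "-2"] this] show ?thesis by simp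
qed

lemma centered_normal_cong:
  assumes "\<And>\<omega>. \<omega> \<in> space M \<Longrightarrow> X \<omega> = Y \<omega>" and "centered_normal M X"
  shows "centered_normal M Y"
proof -
  have "X \<in> borel_measurable M \<longleftrightarrow> Y \<in> borel_measurable M"
    by (rule measurable_cong) (rule assms(1))
  moreover have "distr M lborel X = distr M lborel Y"
    by (rule distr_cong) (use assms(1) in auto)
  moreover have "(AE \<omega> in M. X \<omega> = 0) \<longleftrightarrow> (AE \<omega> in M. Y \<omega> = 0)"
    by (rule AE_cong) (use assms(1) in auto)
  ultimately show ?thesis
    using assms(2) by (auto simp: centered_normal_def distributed_def)
qed

section \<open>The covariance of a Gaussian vector on C(T)\<close>

text \<open>
  A centered Gaussian vector \<open>Z\<close> on \<open>C(T)\<close>, with \<open>T = [a, b]\<close>. Continuity of its covariance in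
  each variable is not assumed; it is derived below.
\<close>
locale gaussian_vector = prob_space M for M :: "'w measure" +
  fixes a b :: real and T :: "real set" and Z :: "'w \<Rightarrow> real \<Rightarrow> real"
  assumes interval: "a \<le> b" "T = {a..b}"
    and gauss: "centered_gaussian_vector M T Z"
begin

lemma compact_T: "compact T"
  by (simp add: interval)

lemma measurable_Z: "Z \<in> M \<rightarrow>\<^sub>M C_borel T"
  using gauss by (simp add: centered_gaussian_vector_def)

lemma Z_in_C_space: "\<omega> \<in> space M \<Longrightarrow> Z \<omega> \<in> mspace (C_space T)"
  using measurable_space[OF measurable_Z] by (simp add: space_C_borel)

lemma continuous_Z: "\<omega> \<in> space M \<Longrightarrow> continuous_on T (Z \<omega>)"
  using C_space_continuous[OF compact_T Z_in_C_space] .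

lemma normal_pairing: "\<mu> \<in> signed_measures T \<Longrightarrow> centered_normal M (\<lambda>\<omega>. pairing T \<mu> (Z \<omega>))"
  using gauss by (simp add: centered_gaussian_vector_def)

lemmas measurable_pairing_Z = centered_normal_measurable[OF normal_pairing]
  and square_integrable_pairing_Z = centered_normal_square_integrable[OF normal_pairing]

lemma normal_eval: "t \<in> T \<Longrightarrow> centered_normal M (\<lambda>\<omega>. Z \<omega> t)"
  by (rule centered_normal_cong[OF _ normal_pairing[OF dirac_signed_measure]])
     (rule pairing_dirac[OF compact_T _ continuous_Z])

lemma normal_increment:
  assumes "s \<in> T" "t \<in> T"
  shows "centered_normal M (\<lambda>\<omega>. Z \<omega> s - Z \<omega> t)"
proof (rule centered_normal_cong[OF _ normal_pairing[OF signed_measures_diff]])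
  show "pairing T (\<lambda>A. dirac T s A - dirac T t A) (Z \<omega>) = Z \<omega> s - Z \<omega> t" if "\<omega> \<in> space M" for \<omega>
    using continuous_Z[OF that] assms
    by (simp add: pairing_diff_measure dirac_signed_measure compact_T pairing_dirac)
qed (rule dirac_signed_measure)+

lemmas measurable_eval = centered_normal_measurable[OF normal_eval]
  and square_integrable_eval = centered_normal_square_integrable[OF normal_eval]

text \<open>Continuity of paths becomes continuity in \<open>L\<^sup>2\<close>, and thence separate continuity of the covariance.\<close>
lemma increment_tendsto_L2:
  assumes "\<And>n. s n \<in> T" "t \<in> T" "s \<longlonglongrightarrow> t"
  shows "(\<lambda>n. \<integral>\<omega>. (Z \<omega> (s n) - Z \<omega> t)\<^sup>2 \<partial>M) \<longlonglongrightarrow> 0"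
proof (rule centered_normal_tendsto_L2)
  show "(\<lambda>n. Z \<omega> (s n) - Z \<omega> t) \<longlonglongrightarrow> 0" if "\<omega> \<in> space M" for \<omega>
    using continuous_on_tendsto_compose[OF continuous_Z[OF that] assms(3,2)] assms(1)
    by (simp add: LIM_zero)
qed (rule normal_increment[OF assms(1,2)])

lemma continuous_cross_moment:
  assumes Y: "Y \<in> borel_measurable M" "integrable M (\<lambda>\<omega>. (Y \<omega>)\<^sup>2)"
  shows "continuous_on T (\<lambda>s. \<integral>\<omega>. Z \<omega> s * Y \<omega> \<partial>M)"
  unfolding continuous_on_sequentially comp_def
proof (intro allI ballI impI, elim conjE)
  fix s :: "nat \<Rightarrow> real" and t
  assume t: "t \<in> T" and s: "\<forall>n. s n \<in> T" "s \<longlonglongrightarrow> t"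
  let ?e = "\<lambda>u. \<integral>\<omega>. Z \<omega> u * Y \<omega> \<partial>M"
  have int: "integrable M (\<lambda>\<omega>. Z \<omega> u * Y \<omega>)" if "u \<in> T" for u
    by (rule integrable_mult_square_integrable[OF measurable_eval[OF that] Y(1) square_integrable_eval[OF that] Y(2)])
  have "(\<lambda>n. ?e (s n) - ?e t) \<longlonglongrightarrow> 0"
  proof (rule Lim_null_comparison)
    show "\<forall>\<^sub>F n in sequentially. norm (?e (s n) - ?e t)
        \<le> sqrt (\<integral>\<omega>. (Z \<omega> (s n) - Z \<omega> t)\<^sup>2 \<partial>M) * sqrt (\<integral>\<omega>. (Y \<omega>)\<^sup>2 \<partial>M)"
    proof (intro always_eventually allI)
      fix n
      have sn: "s n \<in> T" using s by simp
      have "?e (s n) - ?e t = (\<integral>\<omega>. (Z \<omega> (s n) - Z \<omega> t) * Y \<omega> \<partial>M)"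
        using int[OF sn] int[OF t] by (simp add: left_diff_distrib)
      then show "norm (?e (s n) - ?e t)
          \<le> sqrt (\<integral>\<omega>. (Z \<omega> (s n) - Z \<omega> t)\<^sup>2 \<partial>M) * sqrt (\<integral>\<omega>. (Y \<omega>)\<^sup>2 \<partial>M)"
        using Cauchy_Schwarz_integral[OF centered_normal_measurable[OF normal_increment[OF sn t]] Y(1)
            centered_normal_square_integrable[OF normal_increment[OF sn t]] Y(2)]
        by simp
    qed
    have "(\<lambda>n. \<integral>\<omega>. (Z \<omega> (s n) - Z \<omega> t)\<^sup>2 \<partial>M) \<longlonglongrightarrow> 0"
      using increment_tendsto_L2[of s t] s t by simp
    from tendsto_mult[OF tendsto_real_sqrt[OF this] tendsto_const]
    show "(\<lambda>n. sqrt (\<integral>\<omega>. (Z \<omega> (s n) - Z \<omega> t)\<^sup>2 \<partial>M) * sqrt (\<integral>\<omega>. (Y \<omega>)\<^sup>2 \<partial>M)) \<longlonglongrightarrow> 0"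
      by simp
  qed
  then show "(\<lambda>n. ?e (s n)) \<longlonglongrightarrow> ?e t" by (rule LIM_zero_cancel)
qed

lemma continuous_second_moment: "continuous_on T (\<lambda>s. \<integral>\<omega>. (Z \<omega> s)\<^sup>2 \<partial>M)"
  unfolding continuous_on_sequentially comp_def
proof (intro allI ballI impI, elim conjE)
  fix s :: "nat \<Rightarrow> real" and t
  assume t: "t \<in> T" and s: "\<forall>n. s n \<in> T" "s \<longlonglongrightarrow> t"
  let ?d = "\<lambda>n. \<integral>\<omega>. (Z \<omega> (s n) - Z \<omega> t)\<^sup>2 \<partial>M"
  let ?e = "\<lambda>u. \<integral>\<omega>. Z \<omega> u * Z \<omega> t \<partial>M"
  have eq: "(\<integral>\<omega>. (Z \<omega> (s n))\<^sup>2 \<partial>M) = ?d n + 2 * ?e (s n) - (\<integral>\<omega>. (Z \<omega> t)\<^sup>2 \<partial>M)" for n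
  proof -
    have sn: "s n \<in> T" using s by simp
    have i: "integrable M (\<lambda>\<omega>. (Z \<omega> (s n) - Z \<omega> t)\<^sup>2)" "integrable M (\<lambda>\<omega>. Z \<omega> (s n) * Z \<omega> t)"
      "integrable M (\<lambda>\<omega>. (Z \<omega> t)\<^sup>2)"
      using centered_normal_square_integrable[OF normal_increment[OF sn t]] square_integrable_eval[OF t]
        integrable_mult_square_integrable[OF measurable_eval[OF sn] measurable_eval[OF t]
          square_integrable_eval[OF sn] square_integrable_eval[OF t]]
      by auto
    have "(\<integral>\<omega>. (Z \<omega> (s n))\<^sup>2 \<partial>M)
        = (\<integral>\<omega>. (Z \<omega> (s n) - Z \<omega> t)\<^sup>2 + 2 * (Z \<omega> (s n) * Z \<omega> t) - (Z \<omega> t)\<^sup>2 \<partial>M)"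
      by (intro Bochner_Integration.integral_cong) (auto simp: power2_eq_square algebra_simps)
    then show ?thesis using i by simp
  qed
  have "(\<lambda>n. ?e (s n)) \<longlonglongrightarrow> ?e t"
    by (rule continuous_on_tendsto_compose[OF continuous_cross_moment[OF measurable_eval[OF t] square_integrable_eval[OF t]] s(2) t])
       (use s in simp)
  moreover have "?d \<longlonglongrightarrow> 0" using increment_tendsto_L2[of s t] s t by simp
  ultimately have "(\<lambda>n. ?d n + 2 * ?e (s n) - (\<integral>\<omega>. (Z \<omega> t)\<^sup>2 \<partial>M)) \<longlonglongrightarrow> 0 + 2 * ?e t - (\<integral>\<omega>. (Z \<omega> t)\<^sup>2 \<partial>M)"
    by (intro tendsto_intros)
  moreover have "0 + 2 * ?e t - (\<integral>\<omega>. (Z \<omega> t)\<^sup>2 \<partial>M) = (\<integral>\<omega>. (Z \<omega> t)\<^sup>2 \<partial>M)"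
    by (simp add: power2_eq_square)
  ultimately show "(\<lambda>n. \<integral>\<omega>. (Z \<omega> (s n))\<^sup>2 \<partial>M) \<longlonglongrightarrow> (\<integral>\<omega>. (Z \<omega> t)\<^sup>2 \<partial>M)"
    by (simp only: eq)
qed

lemma second_moment_bound:
  obtains C where "0 \<le> C" "\<And>t. t \<in> T \<Longrightarrow> (\<integral>\<omega>. (Z \<omega> t)\<^sup>2 \<partial>M) \<le> C"
  using continuous_on_compact_bound[OF compact_T continuous_second_moment] by (metis abs_le_D1)

text \<open>
  \<open>Z \<omega> t\<close> is the limit of evaluations at the grid points \<open>\<lfloor>t (n + 1)\<rfloor> / (n + 1)\<close>, which are countably
  many for each \<open>n\<close>.
\<close>
lemma jointly_measurable_Z:
  "(\<lambda>(t, \<omega>). Z \<omega> t) \<in> borel_measurable (restrict_space borel T \<Otimes>\<^sub>M M)"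
proof -
  let ?N = "restrict_space borel T \<Otimes>\<^sub>M M"
  \<comment> \<open>Grid points are projected to \<open>T\<close>, outside of which the paths carry no information.\<close>
  define g where "g n i = max a (min b (real_of_int i / real (Suc n)))" for n :: nat and i :: int
  have gT: "g n i \<in> T" for n i using interval by (simp add: g_def)
  define f where "f n p = Z (snd p) (g n \<lfloor>fst p * real (Suc n)\<rfloor>)" for n :: nat and p :: "real \<times> 'w"
  have fst_borel: "(\<lambda>p. fst p) \<in> borel_measurable ?N"
    by (rule measurable_compose[OF measurable_fst]) (rule measurable_restrict_space1, simp)
  have "f n \<in> borel_measurable ?N" for n
    unfolding f_def
  proof (rule measurable_compose_countable)
    show "(\<lambda>p. Z (snd p) (g n i)) \<in> borel_measurable ?N" for i :: int
      by (rule measurable_compose[OF measurable_snd measurable_eval[OF gT]])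
    show "(\<lambda>p. \<lfloor>fst p * real (Suc n)\<rfloor>) \<in> ?N \<rightarrow>\<^sub>M count_space UNIV"
      using fst_borel by measurable
  qed
  then show ?thesis
  proof (rule borel_measurable_LIMSEQ_real[rotated])
    fix p assume "p \<in> space ?N"
    then have t: "fst p \<in> T" and \<omega>: "snd p \<in> space M"
      by (auto simp: space_pair_measure space_restrict_borel)
    have "(\<lambda>n. real_of_int \<lfloor>fst p * real (Suc n)\<rfloor> / real (Suc n)) \<longlonglongrightarrow> fst p"
    proof (rule tendsto_sandwich)
      show "\<forall>\<^sub>F n in sequentially. fst p - inverse (real (Suc n)) \<le> real_of_int \<lfloor>fst p * real (Suc n)\<rfloor> / real (Suc n)"
      proof (intro always_eventually allI)
        fix n
        have "fst p * real (Suc n) - 1 \<le> real_of_int \<lfloor>fst p * real (Suc n)\<rfloor>" by linarith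
        then have "(fst p * real (Suc n) - 1) / real (Suc n) \<le> real_of_int \<lfloor>fst p * real (Suc n)\<rfloor> / real (Suc n)"
          by (rule divide_right_mono) simp
        then show "fst p - inverse (real (Suc n)) \<le> real_of_int \<lfloor>fst p * real (Suc n)\<rfloor> / real (Suc n)"
          by (simp add: diff_divide_distrib inverse_eq_divide del: of_nat_Suc)
      qed
      show "\<forall>\<^sub>F n in sequentially. real_of_int \<lfloor>fst p * real (Suc n)\<rfloor> / real (Suc n) \<le> fst p"
        by (intro always_eventually allI) (simp add: pos_divide_le_eq del: of_nat_Suc)
      show "(\<lambda>n. fst p - inverse (real (Suc n))) \<longlonglongrightarrow> fst p"
        using tendsto_diff[OF tendsto_const LIMSEQ_inverse_real_of_nat, of "fst p"] by simp
    qed simp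
    then have "(\<lambda>n. max a (min b (real_of_int \<lfloor>fst p * real (Suc n)\<rfloor> / real (Suc n)))) \<longlonglongrightarrow> max a (min b (fst p))"
      by (intro tendsto_max tendsto_min tendsto_const)
    moreover have "max a (min b (fst p)) = fst p" using t interval by simp
    ultimately have "(\<lambda>n. g n \<lfloor>fst p * real (Suc n)\<rfloor>) \<longlonglongrightarrow> fst p"
      unfolding g_def by (simp only:)
    then show "(\<lambda>n. f n p) \<longlonglongrightarrow> (case p of (t, \<omega>) \<Rightarrow> Z \<omega> t)"
      unfolding f_def case_prod_beta
      by (rule continuous_on_tendsto_compose[OF continuous_Z[OF \<omega>] _ t]) (simp add: gT)
  qed
qed

text \<open>Fubini's theorem applies because \<open>E \<bar>Z\<^sub>t Y\<bar>\<close> is bounded in \<open>t\<close>.\<close>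
lemma expectation_integral_Z:
  assumes m: "finite_measure m" "sets m = Borel_sets T"
    and Y: "Y \<in> borel_measurable M" "integrable M (\<lambda>\<omega>. (Y \<omega>)\<^sup>2)"
  shows "integrable M (\<lambda>\<omega>. (\<integral>t. Z \<omega> t \<partial>m) * Y \<omega>)"
    and "(\<integral>\<omega>. (\<integral>t. Z \<omega> t \<partial>m) * Y \<omega> \<partial>M) = (\<integral>t. (\<integral>\<omega>. Z \<omega> t * Y \<omega> \<partial>M) \<partial>m)"
proof -
  interpret m: finite_measure m by fact
  interpret P: pair_sigma_finite m M by standard
  have sp: "space m = T"
    using sets_eq_imp_space_eq[OF m(2)] by (simp add: space_restrict_borel)
  let ?f = "\<lambda>t \<omega>. Z \<omega> t * Y \<omega>"
  have Zm: "(\<lambda>(t, \<omega>). Z \<omega> t) \<in> borel_measurable (m \<Otimes>\<^sub>M M)"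
    by (rule borel_measurable_sets_eq[OF sets_pair_measure_cong[OF m(2) refl] jointly_measurable_Z])
  have fm: "case_prod ?f \<in> borel_measurable (m \<Otimes>\<^sub>M M)"
    using borel_measurable_times[OF Zm measurable_compose[OF measurable_snd Y(1)]]
    by (simp add: case_prod_beta)
  obtain C where C: "0 \<le> C" "\<And>t. t \<in> T \<Longrightarrow> (\<integral>\<omega>. (Z \<omega> t)\<^sup>2 \<partial>M) \<le> C"
    using second_moment_bound by blast
  let ?B = "sqrt C * sqrt (\<integral>\<omega>. (Y \<omega>)\<^sup>2 \<partial>M)"
  have i: "integrable M (\<lambda>\<omega>. ?f t \<omega>)" if "t \<in> T" for t
    by (rule integrable_mult_square_integrable[OF measurable_eval[OF that] Y(1) square_integrable_eval[OF that] Y(2)])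
  have bound: "(\<integral>\<omega>. \<bar>?f t \<omega>\<bar> \<partial>M) \<le> ?B" if "t \<in> T" for t
  proof -
    have "(\<integral>\<omega>. \<bar>?f t \<omega>\<bar> \<partial>M) = \<bar>\<integral>\<omega>. \<bar>Z \<omega> t\<bar> * \<bar>Y \<omega>\<bar> \<partial>M\<bar>"
      by (simp add: abs_mult)
    also have "\<dots> \<le> sqrt (\<integral>\<omega>. (Z \<omega> t)\<^sup>2 \<partial>M) * sqrt (\<integral>\<omega>. (Y \<omega>)\<^sup>2 \<partial>M)"
      using Cauchy_Schwarz_integral[of "\<lambda>\<omega>. \<bar>Z \<omega> t\<bar>" M "\<lambda>\<omega>. \<bar>Y \<omega>\<bar>"]
        measurable_eval[OF that] square_integrable_eval[OF that] Y by simp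
    also have "\<dots> \<le> ?B"
      using C(2)[OF that] by (intro mult_right_mono real_sqrt_le_mono) auto
    finally show ?thesis .
  qed
  have int: "integrable (m \<Otimes>\<^sub>M M) (case_prod ?f)"
  proof (rule P.Fubini_integrable[OF fm])
    show "integrable m (\<lambda>t. \<integral>\<omega>. norm (case (t, \<omega>) of (t, \<omega>) \<Rightarrow> ?f t \<omega>) \<partial>M)"
    proof (rule m.integrable_const_bound[where B="?B"])
      show "AE t in m. norm (\<integral>\<omega>. norm (case (t, \<omega>) of (t, \<omega>) \<Rightarrow> ?f t \<omega>) \<partial>M) \<le> ?B"
        using bound sp by (intro AE_I2) simp
      show "(\<lambda>t. \<integral>\<omega>. norm (case (t, \<omega>) of (t, \<omega>) \<Rightarrow> ?f t \<omega>) \<partial>M) \<in> borel_measurable m"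
        using fm by (intro borel_measurable_lebesgue_integral) (simp add: case_prod_beta)
    qed
    show "AE t in m. integrable M (\<lambda>\<omega>. case (t, \<omega>) of (t, \<omega>) \<Rightarrow> ?f t \<omega>)"
      using i sp by (intro AE_I2) simp
  qed
  from P.integrable_snd[OF int] show "integrable M (\<lambda>\<omega>. (\<integral>t. Z \<omega> t \<partial>m) * Y \<omega>)" by simp
  from P.Fubini_integral[OF int]
  show "(\<integral>\<omega>. (\<integral>t. Z \<omega> t \<partial>m) * Y \<omega> \<partial>M) = (\<integral>t. (\<integral>\<omega>. Z \<omega> t * Y \<omega> \<partial>M) \<partial>m)" by simp
qed

lemma expectation_pairing_Z:
  assumes \<mu>: "\<mu> \<in> signed_measures T"
    and Y: "Y \<in> borel_measurable M" "integrable M (\<lambda>\<omega>. (Y \<omega>)\<^sup>2)"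
  shows "(\<integral>\<omega>. pairing T \<mu> (Z \<omega>) * Y \<omega> \<partial>M) = pairing T \<mu> (\<lambda>t. \<integral>\<omega>. Z \<omega> t * Y \<omega> \<partial>M)"
  using expectation_integral_Z[OF finite_measure_jordan_pos[OF \<mu>] sets_jordan_pos Y]
    expectation_integral_Z[OF finite_measure_jordan_neg[OF \<mu>] sets_jordan_neg Y]
  by (simp add: pairing_def left_diff_distrib)

text \<open>
  The centering in \<^const>\<open>cov_fun\<close> has no effect, and \<open>(K \<mu>)(s) = E (Z\<^sub>s \<langle>\<mu>, Z\<rangle>)\<close>,
  \<open>\<langle>\<mu>, K \<nu>\<rangle> = E (\<langle>\<mu>, Z\<rangle> \<langle>\<nu>, Z\<rangle>)\<close>.
\<close>
lemma cov_fun_eq: "s \<in> T \<Longrightarrow> t \<in> T \<Longrightarrow> cov_fun M Z s t = (\<integral>\<omega>. Z \<omega> t * Z \<omega> s \<partial>M)"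
  by (simp add: cov_fun_def centered_normal_expectation[OF normal_eval] mult.commute)

lemma cov_op_eq:
  assumes \<mu>: "\<mu> \<in> signed_measures T" and s: "s \<in> T"
  shows "cov_op M T Z \<mu> s = (\<integral>\<omega>. Z \<omega> s * pairing T \<mu> (Z \<omega>) \<partial>M)"
proof -
  have "cov_op M T Z \<mu> s = pairing T \<mu> (\<lambda>t. \<integral>\<omega>. Z \<omega> t * Z \<omega> s \<partial>M)"
    using s by (simp add: cov_op_def cov_fun_eq cong: pairing_cong)
  also have "\<dots> = (\<integral>\<omega>. pairing T \<mu> (Z \<omega>) * Z \<omega> s \<partial>M)"
    by (rule expectation_pairing_Z[OF \<mu> measurable_eval[OF s] square_integrable_eval[OF s], symmetric])
  finally show ?thesis by (simp add: mult.commute)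
qed

lemma pairing_cov_op:
  assumes \<mu>: "\<mu> \<in> signed_measures T" and \<nu>: "\<nu> \<in> signed_measures T"
  shows "pairing T \<mu> (cov_op M T Z \<nu>) = (\<integral>\<omega>. pairing T \<mu> (Z \<omega>) * pairing T \<nu> (Z \<omega>) \<partial>M)"
  using expectation_pairing_Z[OF \<mu> measurable_pairing_Z[OF \<nu>] square_integrable_pairing_Z[OF \<nu>]]
  by (simp add: cov_op_eq[OF \<nu>] cong: pairing_cong)

lemma cov_op_in_C_space:
  assumes \<mu>: "\<mu> \<in> signed_measures T"
  shows "cov_op M T Z \<mu> \<in> mspace (C_space T)"
proof -
  have "cov_op M T Z \<mu> = (\<lambda>s\<in>T. \<integral>\<omega>. Z \<omega> s * pairing T \<mu> (Z \<omega>) \<partial>M)"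
    using cov_op_eq[OF \<mu>] by (auto simp: fun_eq_iff cov_op_def)
  then show ?thesis
    using C_spaceI[OF compact_T continuous_cross_moment[OF measurable_pairing_Z[OF \<mu>] square_integrable_pairing_Z[OF \<mu>]]]
    by simp
qed

lemma continuous_cov_op: "\<mu> \<in> signed_measures T \<Longrightarrow> continuous_on T (cov_op M T Z \<mu>)"
  using C_space_continuous[OF compact_T cov_op_in_C_space] .

lemma cov_op_diff:
  assumes "\<mu> \<in> signed_measures T" "\<nu> \<in> signed_measures T"
  shows "cov_op M T Z (\<lambda>A. \<mu> A - \<nu> A) = (\<lambda>s\<in>T. cov_op M T Z \<mu> s - cov_op M T Z \<nu> s)"
proof (rule ext)
  fix s
  show "cov_op M T Z (\<lambda>A. \<mu> A - \<nu> A) s = (\<lambda>s\<in>T. cov_op M T Z \<mu> s - cov_op M T Z \<nu> s) s"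
  proof (cases "s \<in> T")
    case True
    have "continuous_on T (\<lambda>t. cov_fun M Z s t)"
      using continuous_cross_moment[OF measurable_eval[OF True] square_integrable_eval[OF True]]
      by (simp add: cov_fun_eq[OF True] cong: continuous_on_cong)
    from pairing_diff_measure[OF assms compact_T this] True show ?thesis by (simp add: cov_op_def)
  qed (simp add: cov_op_def)
qed

lemma cov_op_bound:
  obtains C where "0 \<le> C"
    "\<And>\<mu> s. \<mu> \<in> signed_measures T \<Longrightarrow> s \<in> T \<Longrightarrow> \<bar>cov_op M T Z \<mu> s\<bar> \<le> C * tv_norm T \<mu>"
proof -
  obtain C where C: "0 \<le> C" "\<And>t. t \<in> T \<Longrightarrow> (\<integral>\<omega>. (Z \<omega> t)\<^sup>2 \<partial>M) \<le> C"
    using second_moment_bound by blast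
  have "\<bar>cov_op M T Z \<mu> s\<bar> \<le> C * tv_norm T \<mu>" if \<mu>: "\<mu> \<in> signed_measures T" and s: "s \<in> T" for \<mu> s
  proof -
    let ?K = "\<lambda>t. \<integral>\<omega>. Z \<omega> t * Z \<omega> s \<partial>M"
    have "\<bar>?K t\<bar> \<le> C" if t: "t \<in> T" for t
    proof -
      have "\<bar>?K t\<bar> \<le> sqrt (\<integral>\<omega>. (Z \<omega> t)\<^sup>2 \<partial>M) * sqrt (\<integral>\<omega>. (Z \<omega> s)\<^sup>2 \<partial>M)"
        by (intro Cauchy_Schwarz_integral measurable_eval square_integrable_eval s t)
      also have "\<dots> \<le> sqrt C * sqrt C"
        using C(2)[OF s] C(2)[OF t] C(1) by (intro mult_mono real_sqrt_le_mono) auto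
      finally show ?thesis using C(1) by simp
    qed
    then have "\<bar>pairing T \<mu> ?K\<bar> \<le> C * tv_norm T \<mu>"
      by (intro pairing_bound[OF \<mu> compact_T] C(1) continuous_cross_moment measurable_eval square_integrable_eval s)
    moreover have "cov_op M T Z \<mu> s = pairing T \<mu> ?K"
      using s by (simp add: cov_op_def cov_fun_eq cong: pairing_cong)
    ultimately show ?thesis by simp
  qed
  with C(1) show thesis by (rule that)
qed

end

section \<open>The Hilbert space of the Gaussian law\<close>

lemma C_space_eqI:
  assumes T: "compact T" and h: "h \<in> mspace (C_space T)" "h' \<in> mspace (C_space T)"
    and eq: "\<And>g. g \<in> signed_measures T \<Longrightarrow> pairing T g h = pairing T g h'"
  shows "h = h'"
proof (rule extensionalityI[OF C_space_extensional[OF T h(1)] C_space_extensional[OF T h(2)]])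
  show "h t = h' t" if "t \<in> T" for t
    using eq[OF dirac_signed_measure] pairing_dirac[OF T that C_space_continuous[OF T h(1)]]
      pairing_dirac[OF T that C_space_continuous[OF T h(2)]] by simp
qed

context gaussian_vector
begin

text \<open>The law of \<open>Z\<close>; integrals over it are computed on the probability space.\<close>
abbreviation P\<^sub>0 :: "(real \<Rightarrow> real) measure" where
  "P\<^sub>0 \<equiv> law M T Z"

lemma measurable_law: "f \<in> borel_measurable P\<^sub>0 \<longleftrightarrow> f \<in> borel_measurable (C_borel T)"
  by (simp add: law_def)

lemma integral_law:
  fixes f :: "(real \<Rightarrow> real) \<Rightarrow> real"
  assumes "f \<in> borel_measurable (C_borel T)"
  shows "(\<integral>x. f x \<partial>P\<^sub>0) = (\<integral>\<omega>. f (Z \<omega>) \<partial>M)"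
    and "integrable P\<^sub>0 f \<longleftrightarrow> integrable M (\<lambda>\<omega>. f (Z \<omega>))"
  unfolding law_def using assms measurable_Z by (simp_all add: integral_distr integrable_distr_eq)

lemma measurable_I_star: "\<mu> \<in> signed_measures T \<Longrightarrow> I_star T \<mu> \<in> borel_measurable (C_borel T)"
  using measurable_pairing[OF _ compact_T] by (simp add: I_star_def[abs_def])

lemma L2_inner_law:
  assumes "f \<in> borel_measurable (C_borel T)" "g \<in> borel_measurable (C_borel T)"
  shows "L2_inner P\<^sub>0 f g = (\<integral>\<omega>. f (Z \<omega>) * g (Z \<omega>) \<partial>M)"
  unfolding L2_inner_def by (rule integral_law) (use assms in simp)

lemma L2_norm_law:
  assumes "f \<in> borel_measurable (C_borel T)"
  shows "L2_norm P\<^sub>0 f = sqrt (\<integral>\<omega>. (f (Z \<omega>))\<^sup>2 \<partial>M)"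
  using L2_inner_law[OF assms assms] by (simp add: L2_norm_def power2_eq_square)

lemma L2_space_law:
  assumes "z \<in> L2_space P\<^sub>0"
  shows "z \<in> borel_measurable (C_borel T)" "(\<lambda>\<omega>. z (Z \<omega>)) \<in> borel_measurable M"
    "integrable M (\<lambda>\<omega>. (z (Z \<omega>))\<^sup>2)"
proof -
  show z: "z \<in> borel_measurable (C_borel T)"
    using assms by (simp add: L2_space_def measurable_law)
  show "(\<lambda>\<omega>. z (Z \<omega>)) \<in> borel_measurable M"
    by (rule measurable_compose[OF measurable_Z z])
  show "integrable M (\<lambda>\<omega>. (z (Z \<omega>))\<^sup>2)"
    using assms integral_law(2)[of "\<lambda>x. (z x)\<^sup>2"] z by (simp add: L2_space_def)
qed

lemma I_star_in_X_star:
  assumes \<mu>: "\<mu> \<in> signed_measures T"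
  shows "I_star T \<mu> \<in> X_star T P\<^sub>0"
proof -
  have "integrable P\<^sub>0 (\<lambda>x. (I_star T \<mu> x)\<^sup>2)"
    using integral_law(2)[of "\<lambda>x. (I_star T \<mu> x)\<^sup>2"] measurable_I_star[OF \<mu>]
      square_integrable_pairing_Z[OF \<mu>] by (simp add: I_star_def)
  moreover have "L2_norm P\<^sub>0 (\<lambda>x. I_star T \<mu> x - I_star T \<mu> x) = 0"
    by (simp add: L2_norm_def L2_inner_def)
  ultimately show ?thesis
    using \<mu> measurable_I_star[OF \<mu>] by (auto simp: X_star_def L2_space_def measurable_law intro!: bexI[of _ \<mu>])
qed

text \<open>
  The definite description in \<^const>\<open>I_map\<close> is well defined on all of \<open>L\<^sup>2\<close>: the function
  \<open>s \<mapsto> E (Z\<^sub>s z)\<close> has the required pairings, and Dirac measures separate points of \<open>C(T)\<close>.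
\<close>
lemma pairing_I_map:
  assumes z: "z \<in> L2_space P\<^sub>0"
  shows "I_map T P\<^sub>0 z \<in> mspace (C_space T)"
    and "g \<in> signed_measures T \<Longrightarrow> pairing T g (I_map T P\<^sub>0 z) = (\<integral>\<omega>. pairing T g (Z \<omega>) * z (Z \<omega>) \<partial>M)"
proof -
  note z' = L2_space_law[OF z]
  let ?h = "\<lambda>s\<in>T. \<integral>\<omega>. Z \<omega> s * z (Z \<omega>) \<partial>M"
  have inner: "L2_inner P\<^sub>0 (I_star T g) z = (\<integral>\<omega>. pairing T g (Z \<omega>) * z (Z \<omega>) \<partial>M)"
    if "g \<in> signed_measures T" for g
    using L2_inner_law[OF measurable_I_star[OF that] z'(1)] by (simp add: I_star_def)
  have "?h \<in> mspace (C_space T)"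
    by (rule C_spaceI[OF compact_T continuous_cross_moment[OF z'(2,3)]])
  moreover have "pairing T g ?h = L2_inner P\<^sub>0 (I_star T g) z" if "g \<in> signed_measures T" for g
    using expectation_pairing_Z[OF that z'(2,3)] inner[OF that] by (simp cong: pairing_cong)
  ultimately have "\<exists>!h. h \<in> mspace (C_space T) \<and>
     (\<forall>g\<in>signed_measures T. pairing T g h = L2_inner P\<^sub>0 (I_star T g) z)"
    by (intro ex1I[of _ ?h]) (auto intro!: C_space_eqI[OF compact_T])
  from theI'[OF this, folded I_map_def]
  show "I_map T P\<^sub>0 z \<in> mspace (C_space T)"
    and "g \<in> signed_measures T \<Longrightarrow> pairing T g (I_map T P\<^sub>0 z) = (\<integral>\<omega>. pairing T g (Z \<omega>) * z (Z \<omega>) \<partial>M)"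
    using inner by auto
qed

lemma I_map_I_star:
  assumes \<mu>: "\<mu> \<in> signed_measures T"
  shows "I_map T P\<^sub>0 (I_star T \<mu>) = cov_op M T Z \<mu>"
proof -
  have L2: "I_star T \<mu> \<in> L2_space P\<^sub>0"
    using I_star_in_X_star[OF \<mu>] by (simp add: X_star_def)
  show ?thesis
    by (rule C_space_eqI[OF compact_T pairing_I_map(1)[OF L2] cov_op_in_C_space[OF \<mu>]])
       (simp add: pairing_I_map(2)[OF L2] pairing_cov_op[OF _ \<mu>], simp add: I_star_def)
qed

lemma cov_op_in_H_space: "\<mu> \<in> signed_measures T \<Longrightarrow> cov_op M T Z \<mu> \<in> H_space T P\<^sub>0"
  unfolding H_space_def by (metis I_map_I_star I_star_in_X_star imageI)

text \<open>
  \<open>I\<close> is injective on classes: a difference \<open>d\<close> of two preimages is orthogonal to the range of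
  \<open>I\<^sup>*\<close> and lies in the closure of that range, so it vanishes almost surely.
\<close>
lemma H_norm_cov_op:
  assumes \<nu>: "\<nu> \<in> signed_measures T"
  shows "H_norm T P\<^sub>0 (cov_op M T Z \<nu>) = sqrt (pairing T \<nu> (cov_op M T Z \<nu>))"
proof -
  define z where "z = inv_into (X_star T P\<^sub>0) (I_map T P\<^sub>0) (cov_op M T Z \<nu>)"
  have "cov_op M T Z \<nu> \<in> I_map T P\<^sub>0 ` X_star T P\<^sub>0"
    using cov_op_in_H_space[OF \<nu>] by (simp add: H_space_def)
  then have zX: "z \<in> X_star T P\<^sub>0" and Iz: "I_map T P\<^sub>0 z = cov_op M T Z \<nu>"
    unfolding z_def by (rule inv_into_into, rule f_inv_into_f)
  then have L2: "z \<in> L2_space P\<^sub>0" by (simp add: X_star_def)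
  note z' = L2_space_law[OF L2]
  define n where "n \<omega> = pairing T \<nu> (Z \<omega>)" for \<omega>
  define d where "d \<omega> = z (Z \<omega>) - n \<omega>" for \<omega>
  have n: "n \<in> borel_measurable M" "integrable M (\<lambda>\<omega>. (n \<omega>)\<^sup>2)"
    using measurable_pairing_Z[OF \<nu>] square_integrable_pairing_Z[OF \<nu>] by (simp_all add: n_def[abs_def])
  have square_diff: "integrable M (\<lambda>\<omega>. (u \<omega> - v \<omega>)\<^sup>2)"
    if "u \<in> borel_measurable M" "integrable M (\<lambda>\<omega>. (u \<omega>)\<^sup>2)"
      "v \<in> borel_measurable M" "integrable M (\<lambda>\<omega>. (v \<omega>)\<^sup>2)" for u v :: "'w \<Rightarrow> real"
    using that integrable_mult_square_integrable[OF that(1,3,2,4)] by (simp add: power2_diff mult.assoc)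
  have d: "d \<in> borel_measurable M" "integrable M (\<lambda>\<omega>. (d \<omega>)\<^sup>2)"
    using z' n square_diff[OF z'(2,3) n] by (simp_all add: d_def[abs_def])
  have orth: "(\<integral>\<omega>. pairing T g (Z \<omega>) * d \<omega> \<partial>M) = 0" if g: "g \<in> signed_measures T" for g
  proof -
    have "integrable M (\<lambda>\<omega>. pairing T g (Z \<omega>) * z (Z \<omega>))" "integrable M (\<lambda>\<omega>. pairing T g (Z \<omega>) * n \<omega>)"
      by (intro integrable_mult_square_integrable measurable_pairing_Z square_integrable_pairing_Z g z' n)+
    then show ?thesis
      using pairing_I_map(2)[OF L2 g] pairing_cov_op[OF g \<nu>]
      by (simp add: d_def right_diff_distrib Iz n_def)
  qed
  define D where "D = (\<integral>\<omega>. (d \<omega>)\<^sup>2 \<partial>M)"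
  \<comment> \<open>Split \<open>d = r + \<langle>g, Z\<rangle> - \<langle>\<nu>, Z\<rangle>\<close> with \<open>r\<close> small; \<open>d\<close> is orthogonal to the last two terms.\<close>
  have "sqrt D \<le> e" if e: "e > 0" for e
  proof -
    from zX e obtain g where g: "g \<in> signed_measures T" "L2_norm P\<^sub>0 (\<lambda>x. z x - I_star T g x) < e"
      by (auto simp: X_star_def)
    define r where "r \<omega> = z (Z \<omega>) - pairing T g (Z \<omega>)" for \<omega>
    have r: "r \<in> borel_measurable M" "integrable M (\<lambda>\<omega>. (r \<omega>)\<^sup>2)"
      using z' measurable_pairing_Z[OF g(1)] square_diff[OF z'(2,3) measurable_pairing_Z[OF g(1)] square_integrable_pairing_Z[OF g(1)]]
      by (simp_all add: r_def[abs_def])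
    have re: "sqrt (\<integral>\<omega>. (r \<omega>)\<^sup>2 \<partial>M) < e"
      using g L2_norm_law[of "\<lambda>x. z x - I_star T g x"] z'(1) measurable_I_star[OF g(1)]
      by (simp add: r_def I_star_def)
    have i: "integrable M (\<lambda>\<omega>. r \<omega> * d \<omega>)" "integrable M (\<lambda>\<omega>. pairing T g (Z \<omega>) * d \<omega>)"
      "integrable M (\<lambda>\<omega>. pairing T \<nu> (Z \<omega>) * d \<omega>)"
      by (intro integrable_mult_square_integrable measurable_pairing_Z square_integrable_pairing_Z g \<nu> r d)+
    have "D = (\<integral>\<omega>. r \<omega> * d \<omega> + pairing T g (Z \<omega>) * d \<omega> - pairing T \<nu> (Z \<omega>) * d \<omega> \<partial>M)"
      unfolding D_def
      by (intro Bochner_Integration.integral_cong) (auto simp: r_def d_def n_def power2_eq_square algebra_simps)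
    also have "\<dots> = (\<integral>\<omega>. r \<omega> * d \<omega> \<partial>M)"
      using i orth[OF g(1)] orth[OF \<nu>] by simp
    also have "\<dots> \<le> sqrt (\<integral>\<omega>. (r \<omega>)\<^sup>2 \<partial>M) * sqrt D"
      using Cauchy_Schwarz_integral[OF r(1) d(1) r(2) d(2)] by (simp add: D_def)
    also have "\<dots> \<le> e * sqrt D"
      using re by (intro mult_right_mono) (auto simp: D_def)
    finally have *: "sqrt D * sqrt D \<le> e * sqrt D" by (simp add: D_def)
    show "sqrt D \<le> e"
    proof (cases "D = 0")
      case False
      moreover have "0 \<le> D" by (simp add: D_def)
      ultimately have "0 < sqrt D" by simp
      with * show ?thesis by (simp only: mult_le_cancel_right_pos)
    qed (use e in simp)
  qed
  then have "sqrt D \<le> 0" by (rule field_le_epsilon[of _ 0, simplified])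
  then have D0: "D = 0" by (simp add: D_def antisym)
  have "(\<integral>\<omega>. (z (Z \<omega>))\<^sup>2 \<partial>M) = (\<integral>\<omega>. (n \<omega>)\<^sup>2 + 2 * (n \<omega> * d \<omega>) + (d \<omega>)\<^sup>2 \<partial>M)"
    by (intro Bochner_Integration.integral_cong) (auto simp: d_def power2_eq_square algebra_simps)
  also have "\<dots> = (\<integral>\<omega>. (n \<omega>)\<^sup>2 \<partial>M)"
    using n d integrable_mult_square_integrable[OF n(1) d(1) n(2) d(2)] orth[OF \<nu>] D0
    by (simp add: n_def D_def)
  finally have "(\<integral>\<omega>. (z (Z \<omega>))\<^sup>2 \<partial>M) = pairing T \<nu> (cov_op M T Z \<nu>)"
    using pairing_cov_op[OF \<nu> \<nu>] by (simp add: n_def power2_eq_square)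
  then show ?thesis
    using L2_norm_law[OF z'(1)] by (simp add: H_norm_def H_inner_def L2_norm_def z_def)
qed

section \<open>The quadratic form and the objective\<close>

lemma pairing_cov_op_sym:
  assumes "\<mu> \<in> signed_measures T" "\<nu> \<in> signed_measures T"
  shows "pairing T \<mu> (cov_op M T Z \<nu>) = pairing T \<nu> (cov_op M T Z \<mu>)"
  by (simp add: pairing_cov_op assms mult.commute)

lemma pairing_cov_op_nonneg:
  assumes "\<mu> \<in> signed_measures T"
  shows "0 \<le> pairing T \<mu> (cov_op M T Z \<mu>)"
  by (simp add: pairing_cov_op assms)

lemma pairing_cov_op_diff:
  assumes \<mu>: "\<mu> \<in> signed_measures T" and \<nu>: "\<nu> \<in> signed_measures T"
  shows "pairing T (\<lambda>A. \<mu> A - \<nu> A) (cov_op M T Z (\<lambda>A. \<mu> A - \<nu> A))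
      = pairing T \<mu> (cov_op M T Z \<mu>) - 2 * pairing T \<mu> (cov_op M T Z \<nu>) + pairing T \<nu> (cov_op M T Z \<nu>)"
proof -
  have "pairing T (\<lambda>A. \<mu> A - \<nu> A) (cov_op M T Z (\<lambda>A. \<mu> A - \<nu> A))
      = pairing T (\<lambda>A. \<mu> A - \<nu> A) (\<lambda>s. cov_op M T Z \<mu> s - cov_op M T Z \<nu> s)"
    by (rule pairing_cong) (simp add: cov_op_diff[OF \<mu> \<nu>])
  also have "\<dots> = (pairing T \<mu> (cov_op M T Z \<mu>) - pairing T \<mu> (cov_op M T Z \<nu>))
      - (pairing T \<nu> (cov_op M T Z \<mu>) - pairing T \<nu> (cov_op M T Z \<nu>))"
    using continuous_cov_op[OF \<mu>] continuous_cov_op[OF \<nu>] compact_T \<mu> \<nu>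
    by (simp add: pairing_diff_measure pairing_diff continuous_on_diff)
  finally show ?thesis using pairing_cov_op_sym[OF \<mu> \<nu>] by simp
qed

text \<open>The form \<open>\<langle>\<mu>, K \<mu>\<rangle>\<close> vanishes only on the kernel of \<open>K\<close>.\<close>
lemma cov_op_eq_0:
  assumes \<mu>: "\<mu> \<in> signed_measures T" and 0: "pairing T \<mu> (cov_op M T Z \<mu>) = 0" and s: "s \<in> T"
  shows "cov_op M T Z \<mu> s = 0"
proof -
  have "(\<integral>\<omega>. (pairing T \<mu> (Z \<omega>))\<^sup>2 \<partial>M) = 0"
    using 0 pairing_cov_op[OF \<mu> \<mu>] by (simp add: power2_eq_square)
  then show ?thesis
    using Cauchy_Schwarz_integral[OF measurable_eval[OF s] measurable_pairing_Z[OF \<mu>]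
        square_integrable_eval[OF s] square_integrable_pairing_Z[OF \<mu>]]
    by (simp add: cov_op_eq[OF \<mu> s])
qed

lemma tendsto_pairing:
  assumes \<mu>: "\<mu> \<in> signed_measures T" and ev: "\<forall>\<^sub>F i in F. \<mu>' i \<in> signed_measures T"
    and lim: "((\<lambda>i. tv_norm T (\<lambda>A. \<mu>' i A - \<mu> A)) \<longlongrightarrow> 0) F" and x: "continuous_on T x"
  shows "((\<lambda>i. pairing T (\<mu>' i) x) \<longlongrightarrow> pairing T \<mu> x) F"
proof -
  obtain C where C: "0 \<le> C" "\<And>t. t \<in> T \<Longrightarrow> \<bar>x t\<bar> \<le> C"
    using continuous_on_compact_bound[OF compact_T x] by blast
  have "((\<lambda>i. pairing T (\<mu>' i) x - pairing T \<mu> x) \<longlongrightarrow> 0) F"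
  proof (rule Lim_null_comparison)
    show "\<forall>\<^sub>F i in F. norm (pairing T (\<mu>' i) x - pairing T \<mu> x) \<le> C * tv_norm T (\<lambda>A. \<mu>' i A - \<mu> A)"
      using ev
    proof eventually_elim
      case (elim i)
      show ?case
        using pairing_bound[OF signed_measures_diff[OF elim \<mu>] compact_T x C]
        by (simp add: pairing_diff_measure elim \<mu> compact_T x)
    qed
    show "((\<lambda>i. C * tv_norm T (\<lambda>A. \<mu>' i A - \<mu> A)) \<longlongrightarrow> 0) F"
      using tendsto_mult_right_zero[OF lim] by simp
  qed
  then show ?thesis by (rule LIM_zero_cancel)
qed

lemma tendsto_pairing_cov_op:
  assumes \<mu>: "\<mu> \<in> signed_measures T" and ev: "\<forall>\<^sub>F i in F. \<mu>' i \<in> signed_measures T"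
    and lim: "((\<lambda>i. tv_norm T (\<lambda>A. \<mu>' i A - \<mu> A)) \<longlongrightarrow> 0) F"
  shows "((\<lambda>i. pairing T (\<mu>' i) (cov_op M T Z (\<mu>' i))) \<longlongrightarrow> pairing T \<mu> (cov_op M T Z \<mu>)) F"
proof -
  let ?d = "\<lambda>i A. \<mu>' i A - \<mu> A" and ?K = "cov_op M T Z"
  obtain C where C: "0 \<le> C" "\<And>\<mu> s. \<mu> \<in> signed_measures T \<Longrightarrow> s \<in> T \<Longrightarrow> \<bar>?K \<mu> s\<bar> \<le> C * tv_norm T \<mu>"
    using cov_op_bound by blast
  have "((\<lambda>i. pairing T (?d i) (?K (?d i))) \<longlongrightarrow> 0) F"
  proof (rule Lim_null_comparison)
    show "\<forall>\<^sub>F i in F. norm (pairing T (?d i) (?K (?d i))) \<le> C * tv_norm T (?d i) * tv_norm T (?d i)"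
      using ev
    proof eventually_elim
      case (elim i)
      have d: "?d i \<in> signed_measures T" by (rule signed_measures_diff[OF elim \<mu>])
      show ?case
        using pairing_bound[OF d compact_T continuous_cov_op[OF d], of "C * tv_norm T (?d i)"]
          C(1) C(2)[OF d] tv_norm_nonneg[OF d] by simp
    qed
    show "((\<lambda>i. C * tv_norm T (?d i) * tv_norm T (?d i)) \<longlongrightarrow> 0) F"
      using tendsto_mult_zero[OF tendsto_mult_right_zero[OF lim, of C] lim] by simp
  qed
  moreover have "((\<lambda>i. pairing T (\<mu>' i) (?K \<mu>)) \<longlongrightarrow> pairing T \<mu> (?K \<mu>)) F"
    by (rule tendsto_pairing[OF \<mu> ev lim continuous_cov_op[OF \<mu>]])
  ultimately have "((\<lambda>i. pairing T (?d i) (?K (?d i)) + 2 * pairing T (\<mu>' i) (?K \<mu>) - pairing T \<mu> (?K \<mu>))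
      \<longlongrightarrow> 0 + 2 * pairing T \<mu> (?K \<mu>) - pairing T \<mu> (?K \<mu>)) F"
    by (intro tendsto_intros)
  then have "((\<lambda>i. pairing T (?d i) (?K (?d i)) + 2 * pairing T (\<mu>' i) (?K \<mu>) - pairing T \<mu> (?K \<mu>))
      \<longlongrightarrow> pairing T \<mu> (?K \<mu>)) F" by simp
  then show ?thesis
  proof (rule Lim_transform_eventually)
    show "\<forall>\<^sub>F i in F. pairing T (?d i) (?K (?d i)) + 2 * pairing T (\<mu>' i) (?K \<mu>) - pairing T \<mu> (?K \<mu>)
        = pairing T (\<mu>' i) (?K (\<mu>' i))"
      using ev by eventually_elim (simp add: pairing_cov_op_diff \<mu>)
  qed
qed

text \<open>Completing the square: the noise enters the objective only through \<open>\<epsilon> \<langle>\<mu>\<^sub>\<theta>, Z\<rangle>\<close>.\<close>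
lemma objective_eq:
  assumes \<mu>: "\<mu> \<theta> \<in> signed_measures T" and \<mu>\<^sub>0: "\<mu>\<^sub>0 \<in> signed_measures T" and \<omega>: "\<omega> \<in> space M"
  shows "objective M T Z \<mu> (obs T (cov_op M T Z \<mu>\<^sub>0) Z \<epsilon> \<omega>) \<theta>
    = 1/2 * pairing T \<mu>\<^sub>0 (cov_op M T Z \<mu>\<^sub>0) + \<epsilon> * pairing T (\<mu> \<theta>) (Z \<omega>)
      - 1/2 * pairing T (\<lambda>A. \<mu> \<theta> A - \<mu>\<^sub>0 A) (cov_op M T Z (\<lambda>A. \<mu> \<theta> A - \<mu>\<^sub>0 A))"
proof -
  have "pairing T (\<mu> \<theta>) (obs T (cov_op M T Z \<mu>\<^sub>0) Z \<epsilon> \<omega>)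
      = pairing T (\<mu> \<theta>) (\<lambda>t. cov_op M T Z \<mu>\<^sub>0 t + \<epsilon> * Z \<omega> t)"
    by (rule pairing_cong) (simp add: obs_def)
  also have "\<dots> = pairing T (\<mu> \<theta>) (cov_op M T Z \<mu>\<^sub>0) + \<epsilon> * pairing T (\<mu> \<theta>) (Z \<omega>)"
    using continuous_cov_op[OF \<mu>\<^sub>0] continuous_Z[OF \<omega>]
    by (simp add: pairing_add[OF \<mu> compact_T] pairing_cmult continuous_intros)
  finally show ?thesis
    by (simp add: objective_def pairing_cov_op_diff[OF \<mu> \<mu>\<^sub>0] field_simps)
qed

end

section \<open>Consistency\<close>

lemma tv_norm_zero: "tv_norm T (\<lambda>A. 0) = 0"
proof -
  have "(if T = {} then {} else {T}) \<in> {P. finite P \<and> P \<subseteq> Borel_sets T \<and> partition_on T P}"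
    using Borel_sets_T[of T] by (auto simp: partition_on_def)
  then have "{P. finite P \<and> P \<subseteq> Borel_sets T \<and> partition_on T P} \<noteq> {}" by blast
  then show ?thesis by (simp add: tv_norm_def)
qed

lemma tendsto_unique_zero_compact:
  fixes q :: "'a::metric_space \<Rightarrow> real"
  assumes S: "compact S" and q: "continuous_on S q" "\<And>x. x \<in> S \<Longrightarrow> 0 \<le> q x"
    and unique: "\<And>x. x \<in> S \<Longrightarrow> q x = 0 \<Longrightarrow> x = x\<^sub>0"
    and ev: "\<forall>\<^sub>F i in F. f i \<in> S" and lim: "((\<lambda>i. q (f i)) \<longlongrightarrow> 0) F"
  shows "(f \<longlongrightarrow> x\<^sub>0) F"
proof (rule tendstoI)
  fix e :: real assume e: "0 < e"
  let ?K = "S - ball x\<^sub>0 e"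
  have K: "compact ?K" using S by (simp add: compact_diff)
  show "\<forall>\<^sub>F i in F. dist (f i) x\<^sub>0 < e"
  proof (cases "?K = {}")
    case True
    show ?thesis
      using ev by eventually_elim (use True in \<open>auto simp: dist_commute\<close>)
  next
    case False
    have "continuous_on ?K q" by (rule continuous_on_subset[OF q(1)]) blast
    from continuous_attains_inf[OF K False this]
    obtain x\<^sub>1 where x\<^sub>1: "x\<^sub>1 \<in> ?K" "\<And>x. x \<in> ?K \<Longrightarrow> q x\<^sub>1 \<le> q x"
      by blast
    have "x\<^sub>1 \<noteq> x\<^sub>0" using x\<^sub>1(1) e by auto
    then have "0 < q x\<^sub>1" using q(2)[of x\<^sub>1] unique[of x\<^sub>1] x\<^sub>1(1) by force
    then have "\<forall>\<^sub>F i in F. q (f i) < q x\<^sub>1" using order_tendstoD(2)[OF lim] by blast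
    with ev show ?thesis
    proof eventually_elim
      case (elim i)
      then have "f i \<notin> ?K" using x\<^sub>1(2)[of "f i"] by force
      then show ?case using elim(1) by (simp add: dist_commute)
    qed
  qed
qed

theorem theorem3p10:
  fixes M :: "'w measure"
    and a b :: real
    and T :: "real set"
    and Z :: "'w \<Rightarrow> real \<Rightarrow> real"
    and \<Theta> :: "(real ^ 'p) set"
    and \<theta>\<^sub>0 :: "real ^ 'p"
    and \<mu> :: "real ^ 'p \<Rightarrow> real set \<Rightarrow> real"
    and h\<^sub>0 :: "real \<Rightarrow> real"
    and \<theta>_hat :: "real \<Rightarrow> 'w \<Rightarrow> real ^ 'p"
    and \<mu>_hat :: "real \<Rightarrow> 'w \<Rightarrow> real set \<Rightarrow> real"
    and h_hat :: "real \<Rightarrow> 'w \<Rightarrow> real \<Rightarrow> real"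
  assumes interval: "a \<le> b" "T = {a..b}"
    and prob: "prob_space M"
    and gauss: "centered_gaussian_vector M T Z"
    and compact: "compact \<Theta>"
    and \<theta>\<^sub>0: "\<theta>\<^sub>0 \<in> \<Theta>"
    and \<mu>_in: "\<And>\<theta>. \<theta> \<in> \<Theta> \<Longrightarrow> \<mu> \<theta> \<in> signed_measures T"
    and \<mu>_cont: "\<And>\<theta>. \<theta> \<in> \<Theta> \<Longrightarrow>
        ((\<lambda>\<theta>'. tv_norm T (\<lambda>A. \<mu> \<theta>' A - \<mu> \<theta> A)) \<longlongrightarrow> 0) (at \<theta> within \<Theta>)"
    and identifiable: "\<And>\<theta>. \<theta> \<in> \<Theta> \<Longrightarrow>
        (\<forall>t\<in>T. cov_op M T Z (\<mu> \<theta>) t = cov_op M T Z (\<mu> \<theta>\<^sub>0) t) \<Longrightarrow> \<theta> = \<theta>\<^sub>0"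
    and h\<^sub>0: "h\<^sub>0 = cov_op M T Z (\<mu> \<theta>\<^sub>0)"
    and maximizer: "\<And>\<epsilon> \<omega>. \<epsilon> > 0 \<Longrightarrow> \<omega> \<in> space M \<Longrightarrow>
        is_arg_max (objective M T Z \<mu> (obs T h\<^sub>0 Z \<epsilon> \<omega>)) (\<lambda>\<theta>. \<theta> \<in> \<Theta>) (\<theta>_hat \<epsilon> \<omega>)"
    and \<mu>_hat: "\<And>\<epsilon> \<omega>. \<mu>_hat \<epsilon> \<omega> = \<mu> (\<theta>_hat \<epsilon> \<omega>)"
    and h_hat: "\<And>\<epsilon> \<omega>. h_hat \<epsilon> \<omega> = cov_op M T Z (\<mu>_hat \<epsilon> \<omega>)"
  shows "AE \<omega> in M.
      ((\<lambda>\<epsilon>. \<theta>_hat \<epsilon> \<omega>) \<longlongrightarrow> \<theta>\<^sub>0) (at_right 0) \<and>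
      ((\<lambda>\<epsilon>. tv_norm T (\<lambda>A. \<mu>_hat \<epsilon> \<omega> A - \<mu> \<theta>\<^sub>0 A)) \<longlongrightarrow> 0) (at_right 0) \<and>
      limitin (mtopology_of (C_space T)) (\<lambda>\<epsilon>. h_hat \<epsilon> \<omega>) h\<^sub>0 (at_right 0) \<and>
      h\<^sub>0 \<in> H_space T (law M T Z) \<and>
      (\<forall>\<epsilon>>0. h_hat \<epsilon> \<omega> \<in> H_space T (law M T Z)) \<and>
      ((\<lambda>\<epsilon>. H_norm T (law M T Z) (\<lambda>t\<in>T. h_hat \<epsilon> \<omega> t - h\<^sub>0 t)) \<longlongrightarrow> 0) (at_right 0)"
proof (rule AE_I2)
  interpret gaussian_vector M a b T Z
    using interval prob gauss by (simp add: gaussian_vector_def gaussian_vector_axioms_def)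
  fix \<omega> assume \<omega>: "\<omega> \<in> space M"
  let ?K = "cov_op M T Z"
  \<comment> \<open>\<open>q \<theta>\<close> is the squared \<open>H\<close>-distance of \<open>K \<mu>\<^sub>\<theta>\<close> to \<open>h\<^sub>0\<close>.\<close>
  define \<nu> where "\<nu> \<theta> A = \<mu> \<theta> A - \<mu> \<theta>\<^sub>0 A" for \<theta> A
  define q where "q \<theta> = pairing T (\<nu> \<theta>) (?K (\<nu> \<theta>))" for \<theta>
  define \<theta>h where "\<theta>h \<epsilon> = \<theta>_hat \<epsilon> \<omega>" for \<epsilon>
  note \<mu>\<^sub>0 = \<mu>_in[OF \<theta>\<^sub>0]
  have \<nu>_in: "\<nu> \<theta> \<in> signed_measures T" if "\<theta> \<in> \<Theta>" for \<theta>
    using signed_measures_diff[OF \<mu>_in[OF that] \<mu>\<^sub>0] by (simp add: \<nu>_def[abs_def])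
  have q_eq: "q \<theta> = pairing T (\<mu> \<theta>) (?K (\<mu> \<theta>)) - 2 * pairing T (\<mu> \<theta>) (?K (\<mu> \<theta>\<^sub>0))
      + pairing T (\<mu> \<theta>\<^sub>0) (?K (\<mu> \<theta>\<^sub>0))" if "\<theta> \<in> \<Theta>" for \<theta>
    using pairing_cov_op_diff[OF \<mu>_in[OF that] \<mu>\<^sub>0] by (simp add: q_def \<nu>_def[abs_def])
  have ev_within: "\<forall>\<^sub>F \<theta>' in at \<theta> within \<Theta>. \<mu> \<theta>' \<in> signed_measures T" for \<theta>
    by (rule eventually_at_filter[THEN iffD2]) (use \<mu>_in in auto)
  have cont_pairing: "continuous_on \<Theta> (\<lambda>\<theta>. pairing T (\<mu> \<theta>) x)" if "continuous_on T x" for x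
    unfolding continuous_on_def using tendsto_pairing[OF \<mu>_in ev_within \<mu>_cont that] by blast
  have "continuous_on \<Theta> (\<lambda>\<theta>. pairing T (\<mu> \<theta>) (?K (\<mu> \<theta>)))"
    unfolding continuous_on_def using tendsto_pairing_cov_op[OF \<mu>_in ev_within \<mu>_cont] by blast
  then have q_cont: "continuous_on \<Theta> q"
    using cont_pairing[OF continuous_cov_op[OF \<mu>\<^sub>0]]
    by (subst continuous_on_cong[OF refl q_eq]) (auto intro!: continuous_intros)
  have q_nonneg: "0 \<le> q \<theta>" if "\<theta> \<in> \<Theta>" for \<theta>
    using pairing_cov_op_nonneg[OF \<nu>_in[OF that]] by (simp add: q_def)
  have K\<nu>: "?K (\<nu> \<theta>) = (\<lambda>t\<in>T. ?K (\<mu> \<theta>) t - ?K (\<mu> \<theta>\<^sub>0) t)" if "\<theta> \<in> \<Theta>" for \<theta>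
    using cov_op_diff[OF \<mu>_in[OF that] \<mu>\<^sub>0] by (simp add: \<nu>_def[abs_def])
  have q_unique: "\<theta> = \<theta>\<^sub>0" if "\<theta> \<in> \<Theta>" "q \<theta> = 0" for \<theta>
  proof (rule identifiable[OF that(1)], rule ballI)
    fix t assume t: "t \<in> T"
    have "?K (\<nu> \<theta>) t = 0"
      by (rule cov_op_eq_0[OF \<nu>_in[OF that(1)] _ t]) (use that(2) in \<open>simp add: q_def\<close>)
    then show "?K (\<mu> \<theta>) t = ?K (\<mu> \<theta>\<^sub>0) t" using K\<nu>[OF that(1)] t by simp
  qed
  have \<theta>h_in: "\<theta>h \<epsilon> \<in> \<Theta>" if "0 < \<epsilon>" for \<epsilon>
    using maximizer[OF that \<omega>] by (simp add: is_arg_max_def \<theta>h_def)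
  have pos: "\<forall>\<^sub>F \<epsilon> in at_right (0::real). 0 < \<epsilon>"
    by (simp add: eventually_at_right_less)
  have ev_in: "\<forall>\<^sub>F \<epsilon> in at_right 0. \<theta>h \<epsilon> \<in> \<Theta>"
    using pos by eventually_elim (rule \<theta>h_in)
  have "compact ((\<lambda>\<theta>. pairing T (\<mu> \<theta>) (Z \<omega>)) ` \<Theta>)"
    by (rule compact_continuous_image[OF cont_pairing[OF continuous_Z[OF \<omega>]] compact])
  then obtain B where B: "\<And>\<theta>. \<theta> \<in> \<Theta> \<Longrightarrow> \<bar>pairing T (\<mu> \<theta>) (Z \<omega>)\<bar> \<le> B"
    using compact_imp_bounded by (force simp: bounded_iff)
  \<comment> \<open>Compare the objective at the maximizer with its value at \<open>\<theta>\<^sub>0\<close>, where \<open>q\<close> vanishes.\<close>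
  have q_bound: "q (\<theta>h \<epsilon>) \<le> 4 * B * \<epsilon>" if \<epsilon>: "0 < \<epsilon>" for \<epsilon>
  proof -
    let ?\<Phi> = "objective M T Z \<mu> (obs T h\<^sub>0 Z \<epsilon> \<omega>)"
    have \<Phi>: "?\<Phi> \<theta> = 1/2 * pairing T (\<mu> \<theta>\<^sub>0) (?K (\<mu> \<theta>\<^sub>0)) + \<epsilon> * pairing T (\<mu> \<theta>) (Z \<omega>) - 1/2 * q \<theta>"
      if "\<theta> \<in> \<Theta>" for \<theta>
      using objective_eq[of \<mu> \<theta>, OF \<mu>_in[OF that] \<mu>\<^sub>0 \<omega>] by (simp add: h\<^sub>0 q_def \<nu>_def[abs_def])
    have "?\<Phi> \<theta>\<^sub>0 \<le> ?\<Phi> (\<theta>h \<epsilon>)"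
      using maximizer[OF \<epsilon> \<omega>] \<theta>\<^sub>0 by (auto simp: is_arg_max_def \<theta>h_def not_less)
    moreover have "q \<theta>\<^sub>0 = 0" using q_eq[OF \<theta>\<^sub>0] by simp
    ultimately have "q (\<theta>h \<epsilon>) \<le> 2 * \<epsilon> * (pairing T (\<mu> (\<theta>h \<epsilon>)) (Z \<omega>) - pairing T (\<mu> \<theta>\<^sub>0) (Z \<omega>))"
      by (simp add: \<Phi>[OF \<theta>\<^sub>0] \<Phi>[OF \<theta>h_in[OF \<epsilon>]] algebra_simps)
    also have "\<dots> \<le> 2 * \<epsilon> * (2 * B)"
      using B[OF \<theta>\<^sub>0] B[OF \<theta>h_in[OF \<epsilon>]] \<epsilon> by (intro mult_left_mono) auto
    finally show ?thesis by (simp add: mult_ac)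
  qed
  have q_lim: "((\<lambda>\<epsilon>. q (\<theta>h \<epsilon>)) \<longlongrightarrow> 0) (at_right 0)"
  proof (rule tendsto_sandwich)
    show "\<forall>\<^sub>F \<epsilon> in at_right 0. 0 \<le> q (\<theta>h \<epsilon>)"
      using ev_in by eventually_elim (rule q_nonneg)
    show "\<forall>\<^sub>F \<epsilon> in at_right 0. q (\<theta>h \<epsilon>) \<le> 4 * B * \<epsilon>"
      using pos by eventually_elim (rule q_bound)
    show "((\<lambda>\<epsilon>. 4 * B * \<epsilon>) \<longlongrightarrow> 0) (at_right 0)"
      by (rule tendsto_eq_intros refl | simp)+
  qed simp
  have \<theta>_lim: "(\<theta>h \<longlongrightarrow> \<theta>\<^sub>0) (at_right 0)"
    by (rule tendsto_unique_zero_compact[OF compact q_cont q_nonneg q_unique ev_in q_lim])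
  have tv_lim: "((\<lambda>\<epsilon>. tv_norm T (\<nu> (\<theta>h \<epsilon>))) \<longlongrightarrow> 0) (at_right 0)"
  proof -
    \<comment> \<open>The value at \<open>\<theta>\<^sub>0\<close> is needed because \<open>\<theta>h \<epsilon>\<close> may equal \<open>\<theta>\<^sub>0\<close>, which the limit in the
      hypothesis leaves out.\<close>
    have 0: "tv_norm T (\<nu> \<theta>\<^sub>0) = 0" by (simp add: \<nu>_def[abs_def] tv_norm_zero)
    then have "continuous (at \<theta>\<^sub>0 within \<Theta>) (\<lambda>\<theta>. tv_norm T (\<nu> \<theta>))"
      using \<mu>_cont[OF \<theta>\<^sub>0] by (simp add: continuous_within \<nu>_def[abs_def])
    from continuous_within_tendsto_compose[OF this ev_in \<theta>_lim] 0 show ?thesis by simp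
  qed
  have h_eq: "h_hat \<epsilon> \<omega> = ?K (\<mu> (\<theta>h \<epsilon>))" for \<epsilon>
    by (simp add: h_hat \<mu>_hat \<theta>h_def)
  have "limitin (mtopology_of (C_space T)) (\<lambda>\<epsilon>. h_hat \<epsilon> \<omega>) h\<^sub>0 (at_right 0)"
  proof -
    obtain C where C: "0 \<le> C" "\<And>\<mu> s. \<mu> \<in> signed_measures T \<Longrightarrow> s \<in> T \<Longrightarrow> \<bar>?K \<mu> s\<bar> \<le> C * tv_norm T \<mu>"
      using cov_op_bound by blast
    have "((\<lambda>\<epsilon>. mdist (C_space T) (h_hat \<epsilon> \<omega>) h\<^sub>0) \<longlongrightarrow> 0) (at_right 0)"
    proof (rule Lim_null_comparison)
      show "\<forall>\<^sub>F \<epsilon> in at_right 0. norm (mdist (C_space T) (h_hat \<epsilon> \<omega>) h\<^sub>0) \<le> C * tv_norm T (\<nu> (\<theta>h \<epsilon>))"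
        using ev_in
      proof eventually_elim
        case (elim \<epsilon>)
        have "mdist (C_space T) (h_hat \<epsilon> \<omega>) h\<^sub>0 \<le> C * tv_norm T (\<nu> (\<theta>h \<epsilon>))"
          using C(2)[OF \<nu>_in[OF elim]] C(1) tv_norm_nonneg[OF \<nu>_in[OF elim]] K\<nu>[OF elim]
          by (intro mdist_C_space_le) (simp_all add: h_eq h\<^sub>0)
        then show ?case by simp
      qed
      show "((\<lambda>\<epsilon>. C * tv_norm T (\<nu> (\<theta>h \<epsilon>))) \<longlongrightarrow> 0) (at_right 0)"
        using tendsto_mult_right_zero[OF tv_lim] by simp
    qed
    moreover have "\<forall>\<^sub>F \<epsilon> in at_right 0. h_hat \<epsilon> \<omega> \<in> mspace (C_space T)"
      using ev_in by eventually_elim (simp add: h_eq cov_op_in_C_space \<mu>_in)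
    moreover have "h\<^sub>0 \<in> mspace (C_space T)"
      by (simp add: h\<^sub>0 cov_op_in_C_space \<mu>\<^sub>0)
    ultimately show ?thesis
      unfolding mtopology_of_def
      by (simp add: Metric_space.limitin_metric_dist_null[OF Metric_space_mspace_mdist])
  qed
  moreover have "h\<^sub>0 \<in> H_space T P\<^sub>0"
    by (simp add: h\<^sub>0 cov_op_in_H_space \<mu>\<^sub>0)
  moreover have "\<forall>\<epsilon>>0. h_hat \<epsilon> \<omega> \<in> H_space T P\<^sub>0"
    by (simp add: h_eq cov_op_in_H_space \<mu>_in \<theta>h_in)
  moreover have "((\<lambda>\<epsilon>. H_norm T P\<^sub>0 (\<lambda>t\<in>T. h_hat \<epsilon> \<omega> t - h\<^sub>0 t)) \<longlongrightarrow> 0) (at_right 0)"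
  proof (rule Lim_transform_eventually)
    show "((\<lambda>\<epsilon>. sqrt (q (\<theta>h \<epsilon>))) \<longlongrightarrow> 0) (at_right 0)"
      using tendsto_real_sqrt[OF q_lim] by simp
    show "\<forall>\<^sub>F \<epsilon> in at_right 0. sqrt (q (\<theta>h \<epsilon>)) = H_norm T P\<^sub>0 (\<lambda>t\<in>T. h_hat \<epsilon> \<omega> t - h\<^sub>0 t)"
      using ev_in
    proof eventually_elim
      case (elim \<epsilon>)
      show ?case
        using H_norm_cov_op[OF \<nu>_in[OF elim]] unfolding q_def K\<nu>[OF elim] by (simp add: h_eq h\<^sub>0)
    qed
  qed
  ultimately show "((\<lambda>\<epsilon>. \<theta>_hat \<epsilon> \<omega>) \<longlongrightarrow> \<theta>\<^sub>0) (at_right 0) \<and>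
      ((\<lambda>\<epsilon>. tv_norm T (\<lambda>A. \<mu>_hat \<epsilon> \<omega> A - \<mu> \<theta>\<^sub>0 A)) \<longlongrightarrow> 0) (at_right 0) \<and>
      limitin (mtopology_of (C_space T)) (\<lambda>\<epsilon>. h_hat \<epsilon> \<omega>) h\<^sub>0 (at_right 0) \<and>
      h\<^sub>0 \<in> H_space T (law M T Z) \<and>
      (\<forall>\<epsilon>>0. h_hat \<epsilon> \<omega> \<in> H_space T (law M T Z)) \<and>
      ((\<lambda>\<epsilon>. H_norm T (law M T Z) (\<lambda>t\<in>T. h_hat \<epsilon> \<omega> t - h\<^sub>0 t)) \<longlongrightarrow> 0) (at_right 0)"
    using \<theta>_lim tv_lim by (simp add: \<theta>h_def[abs_def] \<nu>_def[abs_def] \<mu>_hat)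
qed

end
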